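(* Let $(M,[g],\mathbb{PQ})$ be a pqc manifold of dimension $4n+3>7$ with a fixed metric $g\in[g]$ and local compatible data $(\eta_s,I_s)$. Let $\xi_1,\xi_2,\xi_3$ be the unique local vector fields with $\eta_s(\xi_t)=\delta_{st}$ and $(\xi_s\lrcorner d\eta_s)_{|H}=0$, let $V=\mathrm{span}\{\xi_1,\xi_2,\xi_3\}$, and let $\nabla$ be the unique $H$-partial connection on $H$ (i.e. $\nabla_XY\in H$ is defined for $X,Y\in H$) with $\nabla g=0$ and $\nabla_XY-\nabla_YX-[X,Y]_{|H}=0$, where $|H$ is the projection onto $H$ along $V$. Then $\nabla$ preserves the paraquaternionic structure $\mathbb{PQ}$ on $H$, and the vector fields $\xi_1,\xi_2,\xi_3$ satisfy $$\eta_s(\xi_t)=\delta_{st},\qquad (\xi_s\lrcorner d\eta_s)_{|H}=0,\qquad (\xi_j\lrcorner d\eta_i)_{|H}=\epsilon_k(\xi_i\lrcorner d\eta_j)_{|H}$$ for all $s,t\in\{1,2,3\}$ and every cyclic permutation $(i,j,k)$ of $(1,2,3)$.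
   Context: Put $\epsilon_1=\epsilon_2=1$, $\epsilon_3=-1$; $(i,j,k)$ denotes any cyclic permutation of $(1,2,3)$. Exterior derivative: $d\eta(A,B)=A\eta(B)-B\eta(A)-\eta([A,B])$; $\lrcorner$ is interior multiplication. A pqc manifold $(M,[g],\mathbb{PQ})$ is a smooth $(4n+3)$-dimensional manifold $M$ with a codimension-three distribution $H$, a conformal class $[g]$ of metrics of signature $(2n,2n)$ on $H$, and a rank-three bundle $\mathbb{PQ}\subset\mathrm{End}(H)$ locally spanned by $I_1,I_2,I_3$ with $I_s^2=\epsilon_s\,\mathrm{id}_H$, $I_iI_j=-I_jI_i=-\epsilon_kI_k$, $g(I_s\cdot,I_s\cdot)=-\epsilon_s g(\cdot,\cdot)$, and such that locally $H=\bigcap_s\ker\eta_s$ for 1-forms $\eta_1,\eta_2,\eta_3$ with $d\eta_s(X,Y)=-2\epsilon_s g(I_sX,Y)$ for $X,Y\in H$. With $g$ fixed, $(\eta_s,I_s)$ denotes such local data compatible with $g$. "$\nabla$ preserves $\mathbb{PQ}$" means $\nabla_X\sigma\in\Gamma(\mathbb{PQ})$ for every $X\in H$ and every section $\sigma$ of $\mathbb{PQ}$. *)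

theory Defs
  imports "HOL-Analysis.Analysis" "HOL-Library.Function_Algebras"
begin

instantiation "fun" :: (type, real_vector) real_vector
begin

definition scaleR_fun :: "real \<Rightarrow> ('a \<Rightarrow> 'b) \<Rightarrow> 'a \<Rightarrow> 'b"
  where "scaleR_fun c f = (\<lambda>x. c *\<^sub>R f x)"

instance
  by standard (auto simp: scaleR_fun_def fun_eq_iff algebra_simps)

end

definition linear_on :: "'a::real_vector set \<Rightarrow> ('a \<Rightarrow> 'b::real_vector) \<Rightarrow> bool" where
  "linear_on S L \<longleftrightarrow>
     (\<forall>u\<in>S. \<forall>v\<in>S. \<forall>a b. L (a *\<^sub>R u + b *\<^sub>R v) = a *\<^sub>R L u + b *\<^sub>R L v)"


section \<open>Smooth manifolds\<close>

text \<open>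
  Only used for open \<open>S\<close>.
\<close>

fun Ck_on :: "nat \<Rightarrow> 'e::euclidean_space set \<Rightarrow> ('e \<Rightarrow> 'f::real_normed_vector) \<Rightarrow> bool" where
  "Ck_on 0 S f \<longleftrightarrow> continuous_on S f"
| "Ck_on (Suc k) S f \<longleftrightarrow>
     (\<forall>x\<in>S. f differentiable (at x)) \<and> (\<forall>v. Ck_on k S (\<lambda>x. frechet_derivative f (at x) v))"

definition smooth_on :: "'e::euclidean_space set \<Rightarrow> ('e \<Rightarrow> 'f::real_normed_vector) \<Rightarrow> bool" where
  "smooth_on S f \<longleftrightarrow> (\<forall>k. Ck_on k S f)"

text \<open>
  The manifold is the whole type \<open>'m\<close>, and \<open>'e\<close> is the model space, so its dimension is
  \<open>DIM('e)\<close>. A chart is a pair of its domain and its coordinate map.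
\<close>

type_synonym ('m, 'e) atlas = "('m set \<times> ('m \<Rightarrow> 'e)) set"

definition smooth_manifold ::
    "('m::{t2_space,second_countable_topology}, 'e::euclidean_space) atlas \<Rightarrow> bool" where
  "smooth_manifold A \<longleftrightarrow>
     (\<forall>(D, \<phi>)\<in>A. open D \<and> open (\<phi> ` D) \<and> homeomorphism D (\<phi> ` D) \<phi> (inv_into D \<phi>)) \<and>
     (\<Union>(D, \<phi>)\<in>A. D) = UNIV \<and>
     (\<forall>(D, \<phi>)\<in>A. \<forall>(E, \<psi>)\<in>A. smooth_on (\<phi> ` (D \<inter> E)) (\<psi> \<circ> inv_into D \<phi>))"

definition smooth_fun ::
    "('m::topological_space, 'e::euclidean_space) atlas \<Rightarrow> 'm set \<Rightarrow> ('m \<Rightarrow> real) \<Rightarrow> bool" where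
  "smooth_fun A W f \<longleftrightarrow> (\<forall>(D, \<phi>)\<in>A. smooth_on (\<phi> ` (D \<inter> W)) (f \<circ> inv_into D \<phi>))"

definition smooth_near ::
    "('m::topological_space, 'e::euclidean_space) atlas \<Rightarrow> 'm \<Rightarrow> ('m \<Rightarrow> real) \<Rightarrow> bool" where
  "smooth_near A p f \<longleftrightarrow> (\<exists>W. open W \<and> p \<in> W \<and> smooth_fun A W f)"


section \<open>Tangent vectors, vector fields and forms\<close>

text \<open>
  Tangent vectors at \<open>p\<close> are the derivations of the algebra of germs at \<open>p\<close> of smooth functions.
  A derivation is represented on all functions, by \<open>0\<close> on those that are not smooth near \<open>p\<close>.
\<close>

type_synonym 'm tvec = "('m \<Rightarrow> real) \<Rightarrow> real"

definition tangent_space ::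
    "('m::topological_space, 'e::euclidean_space) atlas \<Rightarrow> 'm \<Rightarrow> 'm tvec set" where
  "tangent_space A p = {v.
     (\<forall>f h. smooth_near A p f \<and> smooth_near A p h \<longrightarrow>
        (\<forall>a b. v (\<lambda>q. a * f q + b * h q) = a * v f + b * v h) \<and>
        v (\<lambda>q. f q * h q) = v f * h p + f p * v h) \<and>
     (\<forall>f h. smooth_near A p f \<and> (\<forall>\<^sub>F q in nhds p. f q = h q) \<longrightarrow> v f = v h) \<and>
     (\<forall>f. \<not> smooth_near A p f \<longrightarrow> v f = 0)}"

text \<open>
  Local sections over an open set \<open>W\<close> are total functions on \<open>'m\<close> of which only the values on
  \<open>W\<close> matter.
\<close>

definition vector_field ::
    "('m::topological_space, 'e::euclidean_space) atlas \<Rightarrow> 'm set \<Rightarrow> ('m \<Rightarrow> 'm tvec) \<Rightarrow> bool" where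
  "vector_field A W X \<longleftrightarrow>
     (\<forall>p\<in>W. X p \<in> tangent_space A p) \<and>
     (\<forall>W' f. open W' \<and> W' \<subseteq> W \<and> smooth_fun A W' f \<longrightarrow> smooth_fun A W' (\<lambda>p. X p f))"

definition lie_bracket ::
    "('m::topological_space, 'e::euclidean_space) atlas \<Rightarrow> ('m \<Rightarrow> 'm tvec) \<Rightarrow> ('m \<Rightarrow> 'm tvec)
      \<Rightarrow> 'm \<Rightarrow> 'm tvec" where
  "lie_bracket A X Y p = (\<lambda>f.
     if smooth_near A p f then X p (\<lambda>q. Y q f) - Y p (\<lambda>q. X q f) else 0)"

definition one_form ::
    "('m::topological_space, 'e::euclidean_space) atlas \<Rightarrow> 'm set \<Rightarrow> ('m \<Rightarrow> 'm tvec \<Rightarrow> real)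
      \<Rightarrow> bool" where
  "one_form A W \<eta> \<longleftrightarrow>
     (\<forall>p\<in>W. linear_on (tangent_space A p) (\<eta> p)) \<and>
     (\<forall>W' X. open W' \<and> W' \<subseteq> W \<and> vector_field A W' X \<longrightarrow> smooth_fun A W' (\<lambda>p. \<eta> p (X p)))"

text \<open>
  Differential forms of degree two, and their contractions, are regarded as operators on vector
  fields.
\<close>

definition ext_deriv ::
    "('m::topological_space, 'e::euclidean_space) atlas \<Rightarrow> ('m \<Rightarrow> 'm tvec \<Rightarrow> real)
      \<Rightarrow> ('m \<Rightarrow> 'm tvec) \<Rightarrow> ('m \<Rightarrow> 'm tvec) \<Rightarrow> 'm \<Rightarrow> real" where
  "ext_deriv A \<eta> X Y p =
     X p (\<lambda>q. \<eta> q (Y q)) - Y p (\<lambda>q. \<eta> q (X q)) - \<eta> p (lie_bracket A X Y p)"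

definition interior_mult ::
    "('m \<Rightarrow> 'm tvec) \<Rightarrow> (('m \<Rightarrow> 'm tvec) \<Rightarrow> ('m \<Rightarrow> 'm tvec) \<Rightarrow> 'm \<Rightarrow> real)
      \<Rightarrow> ('m \<Rightarrow> 'm tvec) \<Rightarrow> 'm \<Rightarrow> real" where
  "interior_mult \<xi> \<omega> = (\<lambda>X. \<omega> \<xi> X)"


section \<open>Distributions, endomorphisms and metrics\<close>

definition section_of ::
    "('m::topological_space, 'e::euclidean_space) atlas \<Rightarrow> ('m \<Rightarrow> 'm tvec set) \<Rightarrow> 'm set
      \<Rightarrow> ('m \<Rightarrow> 'm tvec) \<Rightarrow> bool" where
  "section_of A H W X \<longleftrightarrow> vector_field A W X \<and> (\<forall>p\<in>W. X p \<in> H p)"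

definition distribution_of_codim ::
    "('m::topological_space, 'e::euclidean_space) atlas \<Rightarrow> nat \<Rightarrow> ('m \<Rightarrow> 'm tvec set) \<Rightarrow> bool" where
  "distribution_of_codim A c H \<longleftrightarrow>
     (\<exists>r. r + c = DIM('e) \<and>
       (\<forall>p. \<exists>W E. open W \<and> p \<in> W \<and> (\<forall>i<r. vector_field A W (E i)) \<and>
          (\<forall>q\<in>W. inj_on (\<lambda>i. E i q) {..<r} \<and> independent ((\<lambda>i. E i q) ` {..<r}) \<and>
                 H q = span ((\<lambda>i. E i q) ` {..<r}))))"

text \<open>
  Equality of two such operators after restriction to \<open>H\<close> over \<open>U\<close>.
\<close>

definition eq_on_distr ::
    "('m::topological_space, 'e::euclidean_space) atlas \<Rightarrow> ('m \<Rightarrow> 'm tvec set) \<Rightarrow> 'm set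
      \<Rightarrow> (('m \<Rightarrow> 'm tvec) \<Rightarrow> 'm \<Rightarrow> real) \<Rightarrow> (('m \<Rightarrow> 'm tvec) \<Rightarrow> 'm \<Rightarrow> real) \<Rightarrow> bool" where
  "eq_on_distr A H U \<alpha> \<beta> \<longleftrightarrow>
     (\<forall>W X. open W \<and> W \<subseteq> U \<and> section_of A H W X \<longrightarrow> (\<forall>p\<in>W. \<alpha> X p = \<beta> X p))"

text \<open>
  Endomorphisms of a subspace \<open>S\<close> are extended by \<open>0\<close> outside \<open>S\<close>, so that they form a
  linear subspace of the function space.
\<close>

definition End_space :: "'m tvec set \<Rightarrow> ('m tvec \<Rightarrow> 'm tvec) set" where
  "End_space S = {L. linear_on S L \<and> (\<forall>u\<in>S. L u \<in> S) \<and> (\<forall>u. u \<notin> S \<longrightarrow> L u = 0)}"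

definition End_field ::
    "('m::topological_space, 'e::euclidean_space) atlas \<Rightarrow> ('m \<Rightarrow> 'm tvec set) \<Rightarrow> 'm set
      \<Rightarrow> ('m \<Rightarrow> 'm tvec \<Rightarrow> 'm tvec) \<Rightarrow> bool" where
  "End_field A H W \<sigma> \<longleftrightarrow>
     (\<forall>p\<in>W. \<sigma> p \<in> End_space (H p)) \<and>
     (\<forall>W' X. open W' \<and> W' \<subseteq> W \<and> section_of A H W' X \<longrightarrow> section_of A H W' (\<lambda>p. \<sigma> p (X p)))"

definition End_section ::
    "('m::topological_space, 'e::euclidean_space) atlas \<Rightarrow> ('m \<Rightarrow> 'm tvec set)
      \<Rightarrow> ('m \<Rightarrow> ('m tvec \<Rightarrow> 'm tvec) set) \<Rightarrow> 'm set \<Rightarrow> ('m \<Rightarrow> 'm tvec \<Rightarrow> 'm tvec) \<Rightarrow> bool" where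
  "End_section A H Q W \<sigma> \<longleftrightarrow> End_field A H W \<sigma> \<and> (\<forall>p\<in>W. \<sigma> p \<in> Q p)"

definition has_signature ::
    "'a::real_vector set \<Rightarrow> ('a \<Rightarrow> 'a \<Rightarrow> real) \<Rightarrow> nat \<Rightarrow> nat \<Rightarrow> bool" where
  "has_signature S b k l \<longleftrightarrow>
     (\<exists>P N. finite P \<and> finite N \<and> P \<inter> N = {} \<and> card P = k \<and> card N = l \<and>
        independent (P \<union> N) \<and> span (P \<union> N) = S \<and>
        (\<forall>u\<in>P \<union> N. \<forall>v\<in>P \<union> N. u \<noteq> v \<longrightarrow> b u v = 0) \<and>
        (\<forall>u\<in>P. b u u = 1) \<and> (\<forall>u\<in>N. b u u = - 1))"

definition metric_of_signature ::
    "('m::topological_space, 'e::euclidean_space) atlas \<Rightarrow> ('m \<Rightarrow> 'm tvec set) \<Rightarrow> nat \<Rightarrow> nat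
      \<Rightarrow> ('m \<Rightarrow> 'm tvec \<Rightarrow> 'm tvec \<Rightarrow> real) \<Rightarrow> bool" where
  "metric_of_signature A H k l g \<longleftrightarrow>
     (\<forall>p. (\<forall>u\<in>H p. linear_on (H p) (g p u)) \<and> (\<forall>u\<in>H p. \<forall>v\<in>H p. g p u v = g p v u) \<and>
          has_signature (H p) (g p) k l) \<and>
     (\<forall>W X Y. open W \<and> section_of A H W X \<and> section_of A H W Y \<longrightarrow>
        smooth_fun A W (\<lambda>p. g p (X p) (Y p)))"

definition conformal_class ::
    "('m::topological_space, 'e::euclidean_space) atlas \<Rightarrow> ('m \<Rightarrow> 'm tvec set)
      \<Rightarrow> ('m \<Rightarrow> 'm tvec \<Rightarrow> 'm tvec \<Rightarrow> real) \<Rightarrow> ('m \<Rightarrow> 'm tvec \<Rightarrow> 'm tvec \<Rightarrow> real) set" where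
  "conformal_class A H g =
     {g'. \<exists>f. smooth_fun A UNIV f \<and> (\<forall>p. f p > 0) \<and>
              (\<forall>p. \<forall>u\<in>H p. \<forall>v\<in>H p. g' p u v = f p * g p u v)}"


section \<open>Paraquaternionic contact manifolds\<close>

definition eps :: "nat \<Rightarrow> real" where
  "eps s = (if s = 3 then - 1 else 1)"

definition cyclic :: "nat \<Rightarrow> nat \<Rightarrow> nat \<Rightarrow> bool" where
  "cyclic i j k \<longleftrightarrow> (i, j, k) \<in> {(1, 2, 3), (2, 3, 1), (3, 1, 2)}"

text \<open>
  Local data over \<open>W\<close> compatible with the metric \<open>g\<close>; only the indices \<open>1, 2, 3\<close> of \<open>\<eta>\<close> and
  \<open>I\<close> are used.
\<close>

definition compatible_data ::
    "('m::topological_space, 'e::euclidean_space) atlas \<Rightarrow> ('m \<Rightarrow> 'm tvec set)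
      \<Rightarrow> ('m \<Rightarrow> ('m tvec \<Rightarrow> 'm tvec) set) \<Rightarrow> ('m \<Rightarrow> 'm tvec \<Rightarrow> 'm tvec \<Rightarrow> real) \<Rightarrow> 'm set
      \<Rightarrow> (nat \<Rightarrow> 'm \<Rightarrow> 'm tvec \<Rightarrow> real) \<Rightarrow> (nat \<Rightarrow> 'm \<Rightarrow> 'm tvec \<Rightarrow> 'm tvec) \<Rightarrow> bool" where
  "compatible_data A H PQ g W \<eta> I \<longleftrightarrow>
     open W \<and>
     (\<forall>s\<in>{1,2,3}. one_form A W (\<eta> s) \<and> End_field A H W (I s)) \<and>
     (\<forall>p\<in>W. PQ p = span {I 1 p, I 2 p, I 3 p}) \<and>
     (\<forall>p\<in>W. \<forall>u\<in>H p. \<forall>s\<in>{1,2,3}. I s p (I s p u) = eps s *\<^sub>R u) \<and>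
     (\<forall>p\<in>W. \<forall>u\<in>H p. \<forall>i j k. cyclic i j k \<longrightarrow>
        I i p (I j p u) = - I j p (I i p u) \<and> I i p (I j p u) = - (eps k *\<^sub>R I k p u)) \<and>
     (\<forall>p\<in>W. \<forall>u\<in>H p. \<forall>v\<in>H p. \<forall>s\<in>{1,2,3}. g p (I s p u) (I s p v) = - eps s * g p u v) \<and>
     (\<forall>p\<in>W. H p = {u \<in> tangent_space A p. \<forall>s\<in>{1,2,3}. \<eta> s p u = 0}) \<and>
     (\<forall>W' X Y. open W' \<and> W' \<subseteq> W \<and> section_of A H W' X \<and> section_of A H W' Y \<longrightarrow>
        (\<forall>p\<in>W'. \<forall>s\<in>{1,2,3}. ext_deriv A (\<eta> s) X Y p = - 2 * eps s * g p (I s p (X p)) (Y p)))"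

definition pqc_manifold ::
    "nat \<Rightarrow> ('m::{t2_space,second_countable_topology}, 'e::euclidean_space) atlas
      \<Rightarrow> ('m \<Rightarrow> 'm tvec set) \<Rightarrow> ('m \<Rightarrow> 'm tvec \<Rightarrow> 'm tvec \<Rightarrow> real) set
      \<Rightarrow> ('m \<Rightarrow> ('m tvec \<Rightarrow> 'm tvec) set) \<Rightarrow> bool" where
  "pqc_manifold n A H C PQ \<longleftrightarrow>
     smooth_manifold A \<and> DIM('e) = 4 * n + 3 \<and>
     distribution_of_codim A 3 H \<and>
     (\<exists>g. metric_of_signature A H (2 * n) (2 * n) g \<and> C = conformal_class A H g) \<and>
     (\<forall>p. dim (PQ p) = 3) \<and>
     (\<forall>p. \<exists>W g \<eta> I. p \<in> W \<and> g \<in> C \<and> compatible_data A H PQ g W \<eta> I)"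


section \<open>Partial connections\<close>

definition proj_along :: "'a::real_vector set \<Rightarrow> 'a set \<Rightarrow> 'a \<Rightarrow> 'a" where
  "proj_along S V u = (THE w. w \<in> S \<and> u - w \<in> V)"

text \<open>
  An \<open>H\<close>-partial connection on \<open>H\<close> over \<open>U\<close>, acting on local sections; the last conjunct says
  that it is compatible with restriction to smaller open sets.
\<close>

definition partial_connection ::
    "('m::topological_space, 'e::euclidean_space) atlas \<Rightarrow> ('m \<Rightarrow> 'm tvec set) \<Rightarrow> 'm set
      \<Rightarrow> (('m \<Rightarrow> 'm tvec) \<Rightarrow> ('m \<Rightarrow> 'm tvec) \<Rightarrow> 'm \<Rightarrow> 'm tvec) \<Rightarrow> bool" where
  "partial_connection A H U D \<longleftrightarrow>
     (\<forall>W. open W \<and> W \<subseteq> U \<longrightarrow>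
       (\<forall>X Y. section_of A H W X \<and> section_of A H W Y \<longrightarrow> section_of A H W (D X Y)) \<and>
       (\<forall>X X' Y. section_of A H W X \<and> section_of A H W X' \<and> section_of A H W Y \<longrightarrow>
          (\<forall>p\<in>W. D (\<lambda>q. X q + X' q) Y p = D X Y p + D X' Y p)) \<and>
       (\<forall>X Y Y'. section_of A H W X \<and> section_of A H W Y \<and> section_of A H W Y' \<longrightarrow>
          (\<forall>p\<in>W. D X (\<lambda>q. Y q + Y' q) p = D X Y p + D X Y' p)) \<and>
       (\<forall>X Y f. section_of A H W X \<and> section_of A H W Y \<and> smooth_fun A W f \<longrightarrow>
          (\<forall>p\<in>W. D (\<lambda>q. f q *\<^sub>R X q) Y p = f p *\<^sub>R D X Y p \<and>
                 D X (\<lambda>q. f q *\<^sub>R Y q) p = X p f *\<^sub>R Y p + f p *\<^sub>R D X Y p)) \<and>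
       (\<forall>X X' Y Y'. section_of A H W X \<and> section_of A H W Y \<and>
            (\<forall>q\<in>W. X q = X' q \<and> Y q = Y' q) \<longrightarrow> (\<forall>p\<in>W. D X Y p = D X' Y' p)))"

definition metric_connection ::
    "('m::topological_space, 'e::euclidean_space) atlas \<Rightarrow> ('m \<Rightarrow> 'm tvec set) \<Rightarrow> 'm set
      \<Rightarrow> ('m \<Rightarrow> 'm tvec \<Rightarrow> 'm tvec \<Rightarrow> real)
      \<Rightarrow> (('m \<Rightarrow> 'm tvec) \<Rightarrow> ('m \<Rightarrow> 'm tvec) \<Rightarrow> 'm \<Rightarrow> 'm tvec) \<Rightarrow> bool" where
  "metric_connection A H U g D \<longleftrightarrow>
     (\<forall>W X Y Z. open W \<and> W \<subseteq> U \<and> section_of A H W X \<and> section_of A H W Y \<and> section_of A H W Z \<longrightarrow>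
       (\<forall>p\<in>W. X p (\<lambda>q. g q (Y q) (Z q)) - g p (D X Y p) (Z p) - g p (Y p) (D X Z p) = 0))"

definition torsion_free_along ::
    "('m::topological_space, 'e::euclidean_space) atlas \<Rightarrow> ('m \<Rightarrow> 'm tvec set)
      \<Rightarrow> ('m \<Rightarrow> 'm tvec set) \<Rightarrow> 'm set
      \<Rightarrow> (('m \<Rightarrow> 'm tvec) \<Rightarrow> ('m \<Rightarrow> 'm tvec) \<Rightarrow> 'm \<Rightarrow> 'm tvec) \<Rightarrow> bool" where
  "torsion_free_along A H V U D \<longleftrightarrow>
     (\<forall>W X Y. open W \<and> W \<subseteq> U \<and> section_of A H W X \<and> section_of A H W Y \<longrightarrow>
       (\<forall>p\<in>W. D X Y p - D Y X p - proj_along (H p) (V p) (lie_bracket A X Y p) = 0))"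

text \<open>
  The induced derivative of an endomorphism field, \<open>(D\<^sub>X \<sigma>) Y = D\<^sub>X (\<sigma> Y) - \<sigma> (D\<^sub>X Y)\<close>, for \<open>X\<close>
  and \<open>\<sigma>\<close> given over \<open>W\<close>. Its value on a vector \<open>u\<close> of \<open>H p\<close> is computed with an arbitrary
  local section \<open>Y\<close> of \<open>H\<close> through \<open>u\<close>.
\<close>

definition End_deriv ::
    "('m::topological_space, 'e::euclidean_space) atlas \<Rightarrow> ('m \<Rightarrow> 'm tvec set) \<Rightarrow> 'm set
      \<Rightarrow> (('m \<Rightarrow> 'm tvec) \<Rightarrow> ('m \<Rightarrow> 'm tvec) \<Rightarrow> 'm \<Rightarrow> 'm tvec)
      \<Rightarrow> ('m \<Rightarrow> 'm tvec) \<Rightarrow> ('m \<Rightarrow> 'm tvec \<Rightarrow> 'm tvec) \<Rightarrow> 'm \<Rightarrow> 'm tvec \<Rightarrow> 'm tvec" where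
  "End_deriv A H W D X \<sigma> p u =
     (if u \<in> H p
      then THE w. \<forall>W' Y. open W' \<and> p \<in> W' \<and> W' \<subseteq> W \<and> section_of A H W' Y \<and> Y p = u \<longrightarrow>
                    w = D X (\<lambda>q. \<sigma> q (Y q)) p - \<sigma> p (D X Y p)
      else 0)"

definition preserves ::
    "('m::topological_space, 'e::euclidean_space) atlas \<Rightarrow> ('m \<Rightarrow> 'm tvec set) \<Rightarrow> 'm set
      \<Rightarrow> (('m \<Rightarrow> 'm tvec) \<Rightarrow> ('m \<Rightarrow> 'm tvec) \<Rightarrow> 'm \<Rightarrow> 'm tvec)
      \<Rightarrow> ('m \<Rightarrow> ('m tvec \<Rightarrow> 'm tvec) set) \<Rightarrow> bool" where
  "preserves A H U D PQ \<longleftrightarrow>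
     (\<forall>W X \<sigma>. open W \<and> W \<subseteq> U \<and> section_of A H W X \<and> End_section A H PQ W \<sigma> \<longrightarrow>
       End_section A H PQ W (End_deriv A H W D X \<sigma>))"

end

theory Submission
  imports Defs
begin

text \<open>
  Put \<open>\<gamma>(X, Y, Z) = g(\<nabla>\<^sub>X Y, Z)\<close> and \<open>\<omega>\<^sub>s = g(I\<^sub>s \<cdot>, \<cdot>)\<close>, so that
  \<open>(\<nabla>\<^sub>X \<omega>\<^sub>s)(Y, Z) = \<gamma>(X, I\<^sub>s Y, Z) + \<gamma>(X, Y, I\<^sub>s Z)\<close>. Applying \<open>\<eta>\<^sub>s\<close> to the Jacobi identity of three
  sections of \<open>H\<close>, that is, restricting \<open>d(d\<eta>\<^sub>s) = 0\<close> to \<open>H\<close>, expresses the alternation of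
  \<open>\<nabla>\<omega>\<^sub>s\<close> as \<open>\<Sum>\<^sub>t \<beta>\<^sub>s\<^sub>t \<and> \<omega>\<^sub>t\<close>, where \<open>\<beta>\<^sub>s\<^sub>t = - \<epsilon>\<^sub>s \<epsilon>\<^sub>t (\<xi>\<^sub>t \<lrcorner> d\<eta>\<^sub>s)\<close> on \<open>H\<close>
  and \<open>\<beta>\<^sub>s\<^sub>s = 0\<close>. The rest is pointwise algebra over the (para)quaternions, written uniformly in the
  signs \<open>\<epsilon>\<^sub>s\<close>. For \<open>I\<^sub>i\<^sup>2 = -1\<close> the form \<open>\<omega>\<^sub>j + i \<omega>\<^sub>k\<close> has type (2,0) with respect to \<open>I\<^sub>i\<close>, so its
  differential has no (0,3) part; if the rank of \<open>H\<close> is at least 8 there are vectors orthogonal to a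
  quaternionic line, and this yields \<open>\<beta>\<^sub>j\<^sub>k = \<epsilon>\<^sub>i \<beta>\<^sub>k\<^sub>j\<close>, the last identity of the claim. A \<open>\<beta>\<close> with this
  symmetry can be absorbed into \<open>\<gamma>\<close>, and for vanishing \<open>\<beta>\<close> the argument of Hitchin's lemma (closed
  Kaehler forms of a hyperhermitian structure are parallel) gives \<open>\<nabla>\<omega>\<^sub>s = 0\<close>. Hence
  \<open>\<nabla>\<^sub>X I\<^sub>s = \<Sum>\<^sub>t \<beta>\<^sub>s\<^sub>t(X) I\<^sub>t\<close>.
\<close>

section \<open>Smooth functions and vector fields\<close>

lemma Ck_on_subset: "Ck_on k S f \<Longrightarrow> T \<subseteq> S \<Longrightarrow> Ck_on k T f"
  by (induction k arbitrary: f) (auto intro: continuous_on_subset)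

lemma Ck_on_cong:
  assumes "open S" "\<And>x. x \<in> S \<Longrightarrow> f x = h x" "Ck_on k S f"
  shows "Ck_on k S h"
  using assms(2,3)
proof (induction k arbitrary: f h)
  case 0
  then show ?case by (auto cong: continuous_on_cong)
next
  case (Suc k)
  have der: "(h has_derivative frechet_derivative f (at x)) (at x)" if "x \<in> S" for x
  proof -
    have "(f has_derivative frechet_derivative f (at x)) (at x)"
      using Suc.prems(2) that by (simp add: frechet_derivative_works)
    then show ?thesis
      by (rule has_derivative_transform_within_open[OF _ assms(1) that]) (rule Suc.prems(1))
  qed
  have eq: "frechet_derivative f (at x) = frechet_derivative h (at x)" if "x \<in> S" for x
    by (rule frechet_derivative_at[OF der[OF that]])
  have "Ck_on k S (\<lambda>x. frechet_derivative h (at x) v)" for v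
  proof (rule Suc.IH)
    show "Ck_on k S (\<lambda>x. frechet_derivative f (at x) v)" using Suc.prems(2) by simp
  qed (simp add: eq)
  moreover have "h differentiable (at x)" if "x \<in> S" for x
    using der[OF that] by (auto simp: differentiable_def)
  ultimately show ?case by simp
qed

lemma Ck_on_Suc_D: "Ck_on (Suc k) S f \<Longrightarrow> Ck_on k S f"
proof (induction k arbitrary: f)
  case 0
  then show ?case
    by (auto intro!: continuous_at_imp_continuous_on differentiable_imp_continuous_within)
next
  case (Suc k)
  then show ?case by (metis Ck_on.simps(2))
qed

lemma Ck_on_const: "Ck_on k S (\<lambda>x. c)"
  by (induction k arbitrary: c) (auto simp: frechet_derivative_const)

lemma Ck_on_add:
  assumes "open S" "Ck_on k S f" "Ck_on k S h"
  shows "Ck_on k S (\<lambda>x. f x + h x)"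
  using assms(2,3)
proof (induction k arbitrary: f h)
  case 0
  then show ?case by (auto intro: continuous_intros)
next
  case (Suc k)
  have "Ck_on k S (\<lambda>x. frechet_derivative (\<lambda>x. f x + h x) (at x) v)" for v
  proof (rule Ck_on_cong[OF assms(1)])
    show "Ck_on k S (\<lambda>x. frechet_derivative f (at x) v + frechet_derivative h (at x) v)"
      using Suc.prems by (intro Suc.IH) auto
    show "frechet_derivative f (at x) v + frechet_derivative h (at x) v =
        frechet_derivative (\<lambda>x. f x + h x) (at x) v" if "x \<in> S" for x
    proof -
      have "((\<lambda>x. f x + h x) has_derivative (\<lambda>v. frechet_derivative f (at x) v
          + frechet_derivative h (at x) v)) (at x)"
        using Suc.prems that
        by (intro has_derivative_add) (auto simp: frechet_derivative_works)
      from frechet_derivative_at[OF this] show ?thesis by metis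
    qed
  qed
  then show ?case using Suc.prems by auto
qed

lemma Ck_on_mult:
  fixes f h :: "'e::euclidean_space \<Rightarrow> real"
  assumes "open S" "Ck_on k S f" "Ck_on k S h"
  shows "Ck_on k S (\<lambda>x. f x * h x)"
  using assms(2,3)
proof (induction k arbitrary: f h)
  case 0
  then show ?case by (auto intro: continuous_intros)
next
  case (Suc k)
  have "Ck_on k S (\<lambda>x. frechet_derivative (\<lambda>x. f x * h x) (at x) v)" for v
  proof (rule Ck_on_cong[OF assms(1)])
    show "Ck_on k S (\<lambda>x. f x * frechet_derivative h (at x) v + frechet_derivative f (at x) v * h x)"
      \<comment> \<open>The product rule leaves undifferentiated factors, which have to be of class
        \<open>k\<close> as well.\<close>
      using Suc.prems Suc.prems[THEN Ck_on_Suc_D]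
      by (intro Ck_on_add[OF assms(1)] Suc.IH) auto
    show "f x * frechet_derivative h (at x) v + frechet_derivative f (at x) v * h x =
        frechet_derivative (\<lambda>x. f x * h x) (at x) v" if "x \<in> S" for x
    proof -
      have "((\<lambda>x. f x * h x) has_derivative (\<lambda>v. f x * frechet_derivative h (at x) v
          + frechet_derivative f (at x) v * h x)) (at x)"
        using Suc.prems that
        by (intro has_derivative_mult) (auto simp: frechet_derivative_works)
      from frechet_derivative_at[OF this] show ?thesis by metis
    qed
  qed
  then show ?case using Suc.prems by auto
qed

lemma smooth_fun_iff:
  "smooth_fun A W f \<longleftrightarrow> (\<forall>D \<phi> k. (D, \<phi>) \<in> A \<longrightarrow> Ck_on k (\<phi> ` (D \<inter> W)) (\<lambda>x. f (inv_into D \<phi> x)))"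
  unfolding smooth_fun_def smooth_on_def comp_def by auto

lemma smooth_fun_subset:
  assumes "smooth_fun A W f" "W' \<subseteq> W"
  shows "smooth_fun A W' f"
  unfolding smooth_fun_iff
proof (intro allI impI)
  fix D \<phi> k assume "(D, \<phi>) \<in> A"
  then have "Ck_on k (\<phi> ` (D \<inter> W)) (\<lambda>x. f (inv_into D \<phi> x))"
    using assms(1) unfolding smooth_fun_iff by blast
  then show "Ck_on k (\<phi> ` (D \<inter> W')) (\<lambda>x. f (inv_into D \<phi> x))"
    by (rule Ck_on_subset) (use assms(2) in auto)
qed

section \<open>Smooth functions on the manifold and their germs\<close>

locale smooth_mfd =
  fixes A :: "('m::{t2_space,second_countable_topology}, 'e::euclidean_space) atlas"
  assumes smooth_manifold: "smooth_manifold A"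
begin

lemma chart_image_open:
  assumes "(D, \<phi>) \<in> A" "open W"
  shows "open (\<phi> ` (D \<inter> W))"
proof -
  have D: "open D" "open (\<phi> ` D)" "homeomorphism D (\<phi> ` D) \<phi> (inv_into D \<phi>)"
    using assms(1) smooth_manifold unfolding smooth_manifold_def by auto
  have "openin (top_of_set (\<phi> ` D)) (\<phi> ` (D \<inter> W))"
    using homeomorphism_imp_open_map[OF D(3)] assms(2) by (simp add: openin_open_Int)
  then show ?thesis using D(2) openin_open_trans by blast
qed

lemma chart_inj:
  assumes "(D, \<phi>) \<in> A"
  shows "inj_on \<phi> D"
proof -
  have "homeomorphism D (\<phi> ` D) \<phi> (inv_into D \<phi>)"
    using assms smooth_manifold unfolding smooth_manifold_def by auto
  then show ?thesis by (intro inj_on_inverseI[of D "inv_into D \<phi>"]) (simp add: homeomorphism_def)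
qed

lemma smooth_fun_cong:
  assumes "smooth_fun A W f" "open W" "\<And>p. p \<in> W \<Longrightarrow> f p = h p"
  shows "smooth_fun A W h"
  unfolding smooth_fun_def smooth_on_def
proof (clarify)
  fix D \<phi> k assume D: "(D, \<phi>) \<in> A"
  show "Ck_on k (\<phi> ` (D \<inter> W)) (h \<circ> inv_into D \<phi>)"
  proof (rule Ck_on_cong[OF chart_image_open[OF D assms(2)]])
    show "Ck_on k (\<phi> ` (D \<inter> W)) (f \<circ> inv_into D \<phi>)"
      using assms(1) D unfolding smooth_fun_def smooth_on_def by auto
  qed (use chart_inj[OF D] assms(3) in auto)
qed

lemma smooth_fun_const: "smooth_fun A W (\<lambda>p. c)"
  unfolding smooth_fun_iff by (auto intro: Ck_on_const)

lemma smooth_fun_add: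
  assumes "open W" "smooth_fun A W f" "smooth_fun A W h"
  shows "smooth_fun A W (\<lambda>p. f p + h p)"
  using assms(2,3) chart_image_open[OF _ assms(1)]
  unfolding smooth_fun_iff by (intro allI impI Ck_on_add) auto

lemma smooth_fun_mult:
  assumes "open W" "smooth_fun A W f" "smooth_fun A W h"
  shows "smooth_fun A W (\<lambda>p. f p * h p)"
  using assms(2,3) chart_image_open[OF _ assms(1)]
  unfolding smooth_fun_iff by (intro allI impI Ck_on_mult) auto

lemma smooth_fun_diff:
  assumes "open W" "smooth_fun A W f" "smooth_fun A W h"
  shows "smooth_fun A W (\<lambda>p. f p - h p)"
  using smooth_fun_add[OF assms(1,2) smooth_fun_mult[OF assms(1) smooth_fun_const[of W "-1"] assms(3)]]
  by simp

lemma smooth_nearI: "open W \<Longrightarrow> p \<in> W \<Longrightarrow> smooth_fun A W f \<Longrightarrow> smooth_near A p f"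
  unfolding smooth_near_def by blast

lemma smooth_nearE:
  assumes "smooth_near A p f" "open W" "p \<in> W"
  obtains W' where "open W'" "p \<in> W'" "W' \<subseteq> W" "smooth_fun A W' f"
proof -
  obtain W1 where "open W1" "p \<in> W1" "smooth_fun A W1 f"
    using assms(1) unfolding smooth_near_def by blast
  then show ?thesis using assms by (intro that[of "W1 \<inter> W"]) (auto intro: smooth_fun_subset)
qed

lemma smooth_near_const: "smooth_near A p (\<lambda>q. c)"
  by (rule smooth_nearI[of UNIV]) (auto intro: smooth_fun_const)

lemma smooth_near_lin:
  assumes "smooth_near A p f" "smooth_near A p h"
  shows "smooth_near A p (\<lambda>q. a * f q + b * h q)"
proof -
  obtain W where W: "open W" "p \<in> W" "smooth_fun A W f"
    using assms(1) unfolding smooth_near_def by blast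
  obtain W' where W': "open W'" "p \<in> W'" "W' \<subseteq> W" "smooth_fun A W' h"
    using smooth_nearE[OF assms(2) W(1,2)] by blast
  have "smooth_fun A W' f" by (rule smooth_fun_subset[OF W(3) W'(3)])
  with W' show ?thesis
    by (intro smooth_nearI[of W'] smooth_fun_add smooth_fun_mult smooth_fun_const)
qed

lemma smooth_near_mult:
  assumes "smooth_near A p f" "smooth_near A p h"
  shows "smooth_near A p (\<lambda>q. f q * h q)"
proof -
  obtain W where W: "open W" "p \<in> W" "smooth_fun A W f"
    using assms(1) unfolding smooth_near_def by blast
  obtain W' where W': "open W'" "p \<in> W'" "W' \<subseteq> W" "smooth_fun A W' h"
    using smooth_nearE[OF assms(2) W(1,2)] by blast
  have "smooth_fun A W' f" by (rule smooth_fun_subset[OF W(3) W'(3)])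
  with W' show ?thesis by (intro smooth_nearI[of W'] smooth_fun_mult)
qed

lemma smooth_near_cong:
  assumes "smooth_near A p f" "open W" "p \<in> W" "\<And>q. q \<in> W \<Longrightarrow> f q = h q"
  shows "smooth_near A p h"
proof -
  obtain W' where W': "open W'" "p \<in> W'" "W' \<subseteq> W" "smooth_fun A W' f"
    using smooth_nearE[OF assms(1-3)] by blast
  show ?thesis
    by (rule smooth_nearI[OF W'(1,2) smooth_fun_cong[OF W'(4,1)]]) (use W'(3) assms(4) in auto)
qed

end

section \<open>Tangent vectors as derivations\<close>

context
  fixes A :: "('m::topological_space, 'e::euclidean_space) atlas" and p v
  assumes v: "v \<in> tangent_space A p"
begin

lemma tangent_lin:
  "smooth_near A p f \<Longrightarrow> smooth_near A p h \<Longrightarrow> v (\<lambda>q. a * f q + b * h q) = a * v f + b * v h"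
  using v unfolding tangent_space_def by simp

lemma tangent_diff:
  "smooth_near A p f \<Longrightarrow> smooth_near A p h \<Longrightarrow> v (\<lambda>q. f q - h q) = v f - v h"
  using tangent_lin[of f h 1 "-1"] by simp

lemma tangent_add:
  "smooth_near A p f \<Longrightarrow> smooth_near A p h \<Longrightarrow> v (\<lambda>q. f q + h q) = v f + v h"
  using tangent_lin[of f h 1 1] by simp

lemma tangent_mult:
  "smooth_near A p f \<Longrightarrow> smooth_near A p h \<Longrightarrow> v (\<lambda>q. f q * h q) = v f * h p + f p * v h"
  using v unfolding tangent_space_def by simp

lemma tangent_local:
  assumes "smooth_near A p f" "open W" "p \<in> W" "\<And>q. q \<in> W \<Longrightarrow> f q = h q"
  shows "v f = v h"
proof -
  have "\<forall>\<^sub>F q in nhds p. f q = h q" unfolding eventually_nhds using assms(2-4) by blast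
  moreover have "\<And>f h. smooth_near A p f \<and> (\<forall>\<^sub>F q in nhds p. f q = h q) \<Longrightarrow> v f = v h"
    using v unfolding tangent_space_def by simp
  ultimately show ?thesis using assms(1) by blast
qed

lemma tangent_nonsmooth: "\<not> smooth_near A p f \<Longrightarrow> v f = 0"
  using v unfolding tangent_space_def by simp

end

context smooth_mfd
begin

lemma tangent_const:
  assumes v: "v \<in> tangent_space A p" and W: "open W" "p \<in> W" "\<And>q. q \<in> W \<Longrightarrow> f q = c"
  shows "v f = 0"
proof -
  \<comment> \<open>Leibniz rule for 1 = 1 * 1.\<close>
  have "v (\<lambda>q. 1) = 2 * v (\<lambda>q. 1)"
    using tangent_mult[OF v smooth_near_const[of p 1] smooth_near_const[of p 1]] by simp
  then have "v (\<lambda>q. c) = 0"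
    using tangent_lin[OF v smooth_near_const[of p 1] smooth_near_const[of p 1], of c 0] by simp
  moreover have "v (\<lambda>q. c) = v f"
    by (rule tangent_local[OF v smooth_near_const W(1,2)]) (use W(3) in auto)
  ultimately show ?thesis by simp
qed

text \<open>In the locality clause both functions may be taken smooth near \<open>p\<close>, because
  smoothness passes to a function that agrees near \<open>p\<close>.\<close>

lemma tangent_spaceI:
  assumes "\<And>f h a b. smooth_near A p f \<Longrightarrow> smooth_near A p h \<Longrightarrow>
      v (\<lambda>q. a * f q + b * h q) = a * v f + b * v h"
    and "\<And>f h. smooth_near A p f \<Longrightarrow> smooth_near A p h \<Longrightarrow>
      v (\<lambda>q. f q * h q) = v f * h p + f p * v h"
    and "\<And>f h W. smooth_near A p f \<Longrightarrow> smooth_near A p h \<Longrightarrow> open W \<Longrightarrow> p \<in> W \<Longrightarrow>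
      (\<And>q. q \<in> W \<Longrightarrow> f q = h q) \<Longrightarrow> v f = v h"
    and "\<And>f. \<not> smooth_near A p f \<Longrightarrow> v f = 0"
  shows "v \<in> tangent_space A p"
  unfolding tangent_space_def mem_Collect_eq
proof (intro conjI allI impI)
  fix f h assume fh: "smooth_near A p f \<and> (\<forall>\<^sub>F q in nhds p. f q = h q)"
  then obtain W where W: "open W" "p \<in> W" "\<And>q. q \<in> W \<Longrightarrow> f q = h q"
    by (auto simp: eventually_nhds)
  show "v f = v h"
    by (rule assms(3)[of f h W]) (use fh W smooth_near_cong[OF _ W] in auto)
qed (use assms in auto)

lemma subspace_tangent: "subspace (tangent_space A p)"
  unfolding subspace_def
proof (intro conjI allI ballI)
  show "0 \<in> tangent_space A p" by (rule tangent_spaceI) auto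
  fix u v c assume u: "u \<in> tangent_space A p"
  show "c *\<^sub>R u \<in> tangent_space A p"
  proof (rule tangent_spaceI)
    show "(c *\<^sub>R u) f = (c *\<^sub>R u) h" if "smooth_near A p f" "open W" "p \<in> W"
      "\<And>q. q \<in> W \<Longrightarrow> f q = h q" for f h W
      using tangent_local[OF u that] by (simp add: scaleR_fun_def)
  qed (simp_all add: scaleR_fun_def tangent_lin[OF u] tangent_mult[OF u] tangent_nonsmooth[OF u]
      algebra_simps)
  assume v: "v \<in> tangent_space A p"
  show "u + v \<in> tangent_space A p"
  proof (rule tangent_spaceI)
    show "(u + v) f = (u + v) h" if "smooth_near A p f" "open W" "p \<in> W"
      "\<And>q. q \<in> W \<Longrightarrow> f q = h q" for f h W
      using tangent_local[OF u that] tangent_local[OF v that] by simp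
  qed (simp_all add: tangent_lin[OF u] tangent_mult[OF u] tangent_nonsmooth[OF u]
      tangent_lin[OF v] tangent_mult[OF v] tangent_nonsmooth[OF v] algebra_simps)
qed

section \<open>Vector fields and Lie brackets\<close>

lemma vector_field_tangent: "vector_field A W X \<Longrightarrow> p \<in> W \<Longrightarrow> X p \<in> tangent_space A p"
  unfolding vector_field_def by simp

lemma vector_field_smooth:
  "vector_field A W X \<Longrightarrow> open W' \<Longrightarrow> W' \<subseteq> W \<Longrightarrow> smooth_fun A W' f \<Longrightarrow>
    smooth_fun A W' (\<lambda>p. X p f)"
  unfolding vector_field_def by simp

lemma vector_fieldI:
  assumes "\<And>p. p \<in> W \<Longrightarrow> X p \<in> tangent_space A p"
    and "\<And>W' f. open W' \<Longrightarrow> W' \<subseteq> W \<Longrightarrow> smooth_fun A W' f \<Longrightarrow> smooth_fun A W' (\<lambda>p. X p f)"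
  shows "vector_field A W X"
  unfolding vector_field_def using assms by simp

lemma vector_field_subset:
  assumes "vector_field A W X" "W' \<subseteq> W"
  shows "vector_field A W' X"
  using assms(2)
  by (intro vector_fieldI vector_field_tangent[OF assms(1)] vector_field_smooth[OF assms(1)]) auto

lemma vector_field_smooth_near:
  assumes "vector_field A W X" "open W" "p \<in> W" "smooth_near A p f"
  shows "smooth_near A p (\<lambda>q. X q f)"
proof -
  obtain W' where W': "open W'" "p \<in> W'" "W' \<subseteq> W" "smooth_fun A W' f"
    using smooth_nearE[OF assms(4,2,3)] by blast
  then show ?thesis using vector_field_smooth[OF assms(1)] by (intro smooth_nearI[of W']) auto
qed

lemma vector_field_add:
  assumes "vector_field A W X" "vector_field A W Y"
  shows "vector_field A W (\<lambda>q. X q + Y q)"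
proof (rule vector_fieldI)
  show "X p + Y p \<in> tangent_space A p" if "p \<in> W" for p
    using assms that by (intro subspace_add subspace_tangent vector_field_tangent)
  show "smooth_fun A W' (\<lambda>p. (X p + Y p) f)" if "open W'" "W' \<subseteq> W" "smooth_fun A W' f" for W' f
    using assms that by (auto intro: smooth_fun_add vector_field_smooth)
qed

lemma vector_field_scale:
  assumes "vector_field A W X" "smooth_fun A W h"
  shows "vector_field A W (\<lambda>q. h q *\<^sub>R X q)"
proof (rule vector_fieldI)
  show "h p *\<^sub>R X p \<in> tangent_space A p" if "p \<in> W" for p
    using assms that by (intro subspace_scale subspace_tangent vector_field_tangent)
  show "smooth_fun A W' (\<lambda>p. (h p *\<^sub>R X p) f)" if "open W'" "W' \<subseteq> W" "smooth_fun A W' f" for W' f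
    using assms that smooth_fun_subset[OF assms(2) that(2)]
    by (auto simp: scaleR_fun_def intro: smooth_fun_mult vector_field_smooth)
qed

text \<open>The cross terms \<open>Z p f * v h + v f * Z p h\<close> of the second-order Leibniz
  rule are symmetric in the two fields and cancel in the commutator.\<close>

lemma vector_field_lie_bracket:
  assumes W: "open W" and X: "vector_field A W X" and Y: "vector_field A W Y"
  shows "vector_field A W (lie_bracket A X Y)"
proof (rule vector_fieldI)
  fix p assume p: "p \<in> W"
  note Xp = vector_field_tangent[OF X p] and Yp = vector_field_tangent[OF Y p]
  note sX = vector_field_smooth_near[OF X W p] and sY = vector_field_smooth_near[OF Y W p]
  show "lie_bracket A X Y p \<in> tangent_space A p"
  proof (rule tangent_spaceI)
    fix f h a b assume f: "smooth_near A p f" and h: "smooth_near A p h"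
    obtain W1 where W1: "open W1" "p \<in> W1" "W1 \<subseteq> W" "smooth_fun A W1 f"
      using smooth_nearE[OF f W p] by blast
    obtain W2 where W2: "open W2" "p \<in> W2" "W2 \<subseteq> W1" "smooth_fun A W2 h"
      using smooth_nearE[OF h W1(1,2)] by blast
    have near: "smooth_near A q f" "smooth_near A q h" "q \<in> W" if "q \<in> W2" for q
      using that W1 W2 smooth_nearI[of W1 q f] smooth_nearI[of W2 q h] by auto
    have lin: "v (\<lambda>q. Z q (\<lambda>r. a * f r + b * h r)) = a * v (\<lambda>q. Z q f) + b * v (\<lambda>q. Z q h)"
      if v: "v \<in> tangent_space A p" and Z: "vector_field A W Z" for v Z
    proof -
      note sZ = vector_field_smooth_near[OF Z W p]
      \<comment> \<open>The inner identity is available only where \<open>f\<close> and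
        \<open>h\<close> are smooth, so it enters through the locality of \<open>v\<close>.\<close>
      have "v (\<lambda>q. a * Z q f + b * Z q h) = v (\<lambda>q. Z q (\<lambda>r. a * f r + b * h r))"
        by (rule tangent_local[OF v smooth_near_lin[OF sZ[OF f] sZ[OF h]] W2(1,2)])
          (use tangent_lin[OF vector_field_tangent[OF Z]] near in auto)
      then show ?thesis using tangent_lin[OF v sZ[OF f] sZ[OF h]] by simp
    qed
    show "lie_bracket A X Y p (\<lambda>q. a * f q + b * h q) =
        a * lie_bracket A X Y p f + b * lie_bracket A X Y p h"
      using f h smooth_near_lin[OF f h, of a b]
      by (simp add: lie_bracket_def lin[OF Xp Y] lin[OF Yp X] algebra_simps)
    have mult: "v (\<lambda>q. Z q (\<lambda>r. f r * h r)) =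
        v (\<lambda>q. Z q f) * h p + Z p f * v h + v f * Z p h + f p * v (\<lambda>q. Z q h)"
      if v: "v \<in> tangent_space A p" and Z: "vector_field A W Z" for v Z
    proof -
      note sZ = vector_field_smooth_near[OF Z W p]
      note s1 = smooth_near_mult[OF sZ[OF f] h] and s2 = smooth_near_mult[OF f sZ[OF h]]
      have "v (\<lambda>q. Z q f * h q + f q * Z q h) = v (\<lambda>q. Z q (\<lambda>r. f r * h r))"
        using smooth_near_lin[OF s1 s2, of 1 1]
        by (intro tangent_local[OF v _ W2(1,2)])
          (use tangent_mult[OF vector_field_tangent[OF Z]] near in auto)
      then show ?thesis
        using tangent_add[OF v s1 s2] tangent_mult[OF v sZ[OF f] h] tangent_mult[OF v f sZ[OF h]]
        by simp
    qed
    show "lie_bracket A X Y p (\<lambda>q. f q * h q) =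
        lie_bracket A X Y p f * h p + f p * lie_bracket A X Y p h"
      using f h smooth_near_mult[OF f h]
      by (simp add: lie_bracket_def mult[OF Xp Y] mult[OF Yp X] algebra_simps)
  next
    fix f h W' assume f: "smooth_near A p f" and h: "smooth_near A p h"
      and W': "open W'" "p \<in> W'" and eq: "\<And>q. q \<in> W' \<Longrightarrow> f q = h q"
    obtain W1 where W1: "open W1" "p \<in> W1" "W1 \<subseteq> W \<inter> W'" "smooth_fun A W1 f"
      using smooth_nearE[OF f, of "W \<inter> W'"] W p W' by auto
    have *: "Z q f = Z q h" if "q \<in> W1" "vector_field A W Z" for q Z
      by (rule tangent_local[OF vector_field_tangent[OF that(2)] smooth_nearI[OF W1(1) that(1) W1(4)]
            W1(1) that(1)]) (use that W1 eq in auto)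
    have "v (\<lambda>q. Z q f) = v (\<lambda>q. Z q h)"
      if v: "v \<in> tangent_space A p" and Z: "vector_field A W Z" for v Z
      by (rule tangent_local[OF v vector_field_smooth_near[OF Z W p f] W1(1,2)]) (use * Z in auto)
    from this[OF Xp Y] this[OF Yp X] f h show "lie_bracket A X Y p f = lie_bracket A X Y p h"
      by (simp add: lie_bracket_def)
  qed (simp add: lie_bracket_def)
next
  fix W' f assume W': "open W'" "W' \<subseteq> W" "smooth_fun A W' f"
  have "smooth_fun A W' (\<lambda>p. X p (\<lambda>q. Y q f) - Y p (\<lambda>q. X q f))"
    using W' by (intro smooth_fun_diff vector_field_smooth[OF X] vector_field_smooth[OF Y]) auto
  then show "smooth_fun A W' (\<lambda>p. lie_bracket A X Y p f)"
    by (rule smooth_fun_cong) (use W' in \<open>auto simp: lie_bracket_def intro: smooth_nearI\<close>)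
qed

text \<open>The bracket at \<open>p\<close> sees only the germ of \<open>X\<close>, so
  \<open>X\<close> may be replaced by a formula valid on \<open>W\<close> only.\<close>

lemma lie_bracket_local:
  assumes X: "vector_field A W X" and Z: "vector_field A W Z"
    and W: "open W" "p \<in> W" "\<And>q. q \<in> W \<Longrightarrow> X q = X' q"
  shows "lie_bracket A X Z p = lie_bracket A X' Z p"
proof
  fix f
  have "Z p (\<lambda>q. X q f) = Z p (\<lambda>q. X' q f)" if "smooth_near A p f"
    by (rule tangent_local[OF vector_field_tangent[OF Z W(2)]
          vector_field_smooth_near[OF X W(1,2) that] W(1,2)]) (simp add: W(3))
  then show "lie_bracket A X Z p f = lie_bracket A X' Z p f"
    using W by (auto simp: lie_bracket_def)
qed

lemma lie_bracket_swap: "lie_bracket A X Y p = - lie_bracket A Y X p"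
  by (auto simp: lie_bracket_def fun_eq_iff)

lemma lie_bracket_add_left:
  assumes X: "vector_field A W X" and Y: "vector_field A W Y" and Z: "vector_field A W Z"
    and W: "open W" "p \<in> W"
  shows "lie_bracket A (\<lambda>q. X q + Y q) Z p = lie_bracket A X Z p + lie_bracket A Y Z p"
proof
  fix f
  show "lie_bracket A (\<lambda>q. X q + Y q) Z p f = (lie_bracket A X Z p + lie_bracket A Y Z p) f"
    using tangent_add[OF vector_field_tangent[OF Z W(2)] vector_field_smooth_near[OF X W, of f]
        vector_field_smooth_near[OF Y W, of f]]
    by (auto simp: lie_bracket_def)
qed

lemma lie_bracket_scale_left:
  assumes X: "vector_field A W X" and Z: "vector_field A W Z" and h: "smooth_fun A W h"
    and W: "open W" "p \<in> W"
  shows "lie_bracket A (\<lambda>q. h q *\<^sub>R X q) Z p = h p *\<^sub>R lie_bracket A X Z p - Z p h *\<^sub>R X p"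
proof
  fix f
  show "lie_bracket A (\<lambda>q. h q *\<^sub>R X q) Z p f = (h p *\<^sub>R lie_bracket A X Z p - Z p h *\<^sub>R X p) f"
    \<comment> \<open>If \<open>f\<close> is not smooth near \<open>p\<close>, both sides are 0,
      since tangent vectors vanish on such functions.\<close>
    using tangent_mult[OF vector_field_tangent[OF Z W(2)] smooth_nearI[OF W h]
        vector_field_smooth_near[OF X W, of f]]
      tangent_nonsmooth[OF vector_field_tangent[OF X W(2)], of f]
    by (auto simp: lie_bracket_def scaleR_fun_def algebra_simps)
qed

lemma jacobi:
  assumes X: "vector_field A W X" and Y: "vector_field A W Y" and Z: "vector_field A W Z"
    and W: "open W" "p \<in> W"
  shows "lie_bracket A (lie_bracket A X Y) Z p + lie_bracket A (lie_bracket A Y Z) X p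
    + lie_bracket A (lie_bracket A Z X) Y p = 0"
proof
  fix f
  \<comment> \<open>Each double bracket yields four third-order terms; the twelve terms of the
    cyclic sum cancel in pairs.\<close>
  have main: "lie_bracket A (lie_bracket A X Y) Z p f = X p (\<lambda>q. Y q (\<lambda>r. Z r f))
      - Y p (\<lambda>q. X q (\<lambda>r. Z r f)) - Z p (\<lambda>q. X q (\<lambda>r. Y r f)) + Z p (\<lambda>q. Y q (\<lambda>r. X r f))"
    if f: "smooth_near A p f"
      and X: "vector_field A W X" and Y: "vector_field A W Y" and Z: "vector_field A W Z" for X Y Z
  proof -
    obtain W1 where W1: "open W1" "p \<in> W1" "W1 \<subseteq> W" "smooth_fun A W1 f"
      using smooth_nearE[OF f W] by blast
    note s = vector_field_smooth_near[OF X W] vector_field_smooth_near[OF Y W]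
      vector_field_smooth_near[OF Z W]
    note d = tangent_diff[OF vector_field_tangent[OF Z W(2)] s(1)[OF s(2)[OF f]] s(2)[OF s(1)[OF f]]]
    have "Z p (\<lambda>q. lie_bracket A X Y q f) = Z p (\<lambda>q. X q (\<lambda>r. Y r f) - Y q (\<lambda>r. X r f))"
      by (rule tangent_local[OF vector_field_tangent[OF Z W(2)] vector_field_smooth_near[OF
              vector_field_lie_bracket[OF W(1) X Y] W f] W1(1,2)])
        (use W1 smooth_nearI in \<open>auto simp: lie_bracket_def\<close>)
    with d s(3)[OF f] f show ?thesis by (simp add: lie_bracket_def)
  qed
  show "(lie_bracket A (lie_bracket A X Y) Z p + lie_bracket A (lie_bracket A Y Z) X p
    + lie_bracket A (lie_bracket A Z X) Y p) f = 0 f"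
  proof (cases "smooth_near A p f")
    case True
    show ?thesis
      using main[OF True X Y Z] main[OF True Y Z X] main[OF True Z X Y] by simp
  qed (simp add: lie_bracket_def)
qed

end

section \<open>Paraquaternionic linear algebra\<close>

lemma linear_onD:
  assumes L: "linear_on S L" and S: "subspace S"
  shows "u \<in> S \<Longrightarrow> v \<in> S \<Longrightarrow> L (u + v) = L u + L v"
    and "u \<in> S \<Longrightarrow> v \<in> S \<Longrightarrow> L (u - v) = L u - L v"
    and "u \<in> S \<Longrightarrow> L (c *\<^sub>R u) = c *\<^sub>R L u"
    and "u \<in> S \<Longrightarrow> L (- u) = - L u"
    and "L 0 = 0"
proof -
  have *: "L (a *\<^sub>R u + b *\<^sub>R v) = a *\<^sub>R L u + b *\<^sub>R L v" if "u \<in> S" "v \<in> S" for u v a b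
    using L that unfolding linear_on_def by blast
  show "u \<in> S \<Longrightarrow> v \<in> S \<Longrightarrow> L (u + v) = L u + L v" "u \<in> S \<Longrightarrow> v \<in> S \<Longrightarrow> L (u - v) = L u - L v"
    using *[of u v 1 1] *[of u v 1 "-1"] by simp_all
  show "u \<in> S \<Longrightarrow> L (c *\<^sub>R u) = c *\<^sub>R L u" "u \<in> S \<Longrightarrow> L (- u) = - L u"
    using *[of u u c 0] *[of u u "-1" 0] by simp_all
  show "L 0 = 0" using *[OF subspace_0[OF S] subspace_0[OF S], of 0 0] by simp
qed

lemma scaleR_fun_apply: "(c *\<^sub>R f) x = c *\<^sub>R f x"
  by (simp add: scaleR_fun_def)

text \<open>Models a fibre of \<open>H\<close> with its metric. The squares of \<open>I\<close>,
  \<open>J\<close>, \<open>K\<close> are kept as parameters, and the multiplication table is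
  invariant under rotating \<open>I\<close>, \<open>J\<close>, \<open>K\<close> together with
  \<open>e\<close>, \<open>f\<close>, \<open>h\<close>.\<close>

locale quat_space =
  fixes S :: "'v::real_vector set" and b :: "'v \<Rightarrow> 'v \<Rightarrow> real" and I J K :: "'v \<Rightarrow> 'v"
    and e f h :: real
  assumes subspace: "subspace S"
    and b_linear: "\<And>u. u \<in> S \<Longrightarrow> linear_on S (b u)"
    and b_sym: "\<And>u v. u \<in> S \<Longrightarrow> v \<in> S \<Longrightarrow> b u v = b v u"
    and closed: "\<And>u. u \<in> S \<Longrightarrow> I u \<in> S" "\<And>u. u \<in> S \<Longrightarrow> J u \<in> S" "\<And>u. u \<in> S \<Longrightarrow> K u \<in> S"
    and products: "\<And>u. u \<in> S \<Longrightarrow> I (J u) = - h *\<^sub>R K u" "\<And>u. u \<in> S \<Longrightarrow> J (I u) = h *\<^sub>R K u"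
      "\<And>u. u \<in> S \<Longrightarrow> J (K u) = - e *\<^sub>R I u" "\<And>u. u \<in> S \<Longrightarrow> K (J u) = e *\<^sub>R I u"
      "\<And>u. u \<in> S \<Longrightarrow> K (I u) = - f *\<^sub>R J u" "\<And>u. u \<in> S \<Longrightarrow> I (K u) = f *\<^sub>R J u"
      "\<And>u. u \<in> S \<Longrightarrow> I (I u) = e *\<^sub>R u" "\<And>u. u \<in> S \<Longrightarrow> J (J u) = f *\<^sub>R u"
      "\<And>u. u \<in> S \<Longrightarrow> K (K u) = h *\<^sub>R u"
    and skew: "\<And>u v. u \<in> S \<Longrightarrow> v \<in> S \<Longrightarrow> b (I u) v = - b u (I v)"
      "\<And>u v. u \<in> S \<Longrightarrow> v \<in> S \<Longrightarrow> b (J u) v = - b u (J v)"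
      "\<And>u v. u \<in> S \<Longrightarrow> v \<in> S \<Longrightarrow> b (K u) v = - b u (K v)"
    and nonzero: "e \<noteq> 0" "f \<noteq> 0" "h \<noteq> 0"
begin

definition qcomb :: "real \<Rightarrow> real \<Rightarrow> real \<Rightarrow> real \<Rightarrow> 'v \<Rightarrow> 'v" where
  "qcomb c0 c1 c2 c3 y = c0 *\<^sub>R y + (c1 *\<^sub>R I y + (c2 *\<^sub>R J y + c3 *\<^sub>R K y))"

text \<open>By skew-symmetry of \<open>I\<close>, \<open>J\<close>, \<open>K\<close> this is
  orthogonality of the quaternionic lines of \<open>y\<close> and \<open>x\<close>, hence a
  symmetric relation.\<close>

definition qorth :: "'v \<Rightarrow> 'v \<Rightarrow> bool" where
  "qorth y x \<longleftrightarrow> b y x = 0 \<and> b y (I x) = 0 \<and> b y (J x) = 0 \<and> b y (K x) = 0"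

lemmas S_simps = subspace_add[OF subspace] subspace_diff[OF subspace] subspace_scale[OF subspace]
  subspace_neg[OF subspace] closed

lemmas b_simps = linear_onD[OF b_linear subspace]

lemma qcomb_closed: "y \<in> S \<Longrightarrow> qcomb c0 c1 c2 c3 y \<in> S"
  unfolding qcomb_def by (intro S_simps)

lemma b_qcomb: "u \<in> S \<Longrightarrow> y \<in> S \<Longrightarrow>
    b u (qcomb c0 c1 c2 c3 y) = c0 * b u y + c1 * b u (I y) + c2 * b u (J y) + c3 * b u (K y)"
  unfolding qcomb_def by (simp add: b_simps S_simps)

lemma b_self: "y \<in> S \<Longrightarrow> b y (I y) = 0" "y \<in> S \<Longrightarrow> b y (J y) = 0" "y \<in> S \<Longrightarrow> b y (K y) = 0"
  using skew[of y y] b_sym[of "I y" y] b_sym[of "J y" y] b_sym[of "K y" y] closed by auto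

lemma qorth_iff:
  assumes "y \<in> S" "x \<in> S"
  shows "qorth y x \<longleftrightarrow> b y x = 0 \<and> b (I y) x = 0 \<and> b (J y) x = 0 \<and> b (K y) x = 0"
  using skew assms unfolding qorth_def by auto

lemma qorth_sym: "y \<in> S \<Longrightarrow> x \<in> S \<Longrightarrow> qorth y x \<Longrightarrow> qorth x y"
  using b_sym closed by (simp add: qorth_def[of x y] qorth_iff[of y x])

lemma qorth_qcomb:
  assumes "y \<in> S" "z \<in> S" "qorth z y"
  shows "qorth z (qcomb c0 c1 c2 c3 y)"
  unfolding qorth_iff[OF assms(2) qcomb_closed[OF assms(1)]]
  using assms by (simp add: b_qcomb closed skew products b_simps S_simps qorth_def)

text \<open>The vectors \<open>y\<close>, \<open>I y\<close>, \<open>J y\<close>, \<open>K y\<close>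
  are orthogonal, with squared lengths \<open>b y y\<close> times 1, \<open>- e\<close>,
  \<open>- f\<close>, \<open>- h\<close>; the witnesses are the resulting projection
  coefficients.\<close>

lemma qorth_projection:
  assumes y: "y \<in> S" and nn: "b y y \<noteq> 0" and x: "x \<in> S"
  obtains c0 c1 c2 c3 where "qorth y (x - qcomb c0 c1 c2 c3 y)"
proof
  show "qorth y (x - qcomb (b y x / b y y) (- b (I y) x / (e * b y y)) (- b (J y) x / (f * b y y))
      (- b (K y) x / (h * b y y)) y)"
    unfolding qorth_iff[OF y subspace_diff[OF subspace x qcomb_closed[OF y]]]
    using y x nn nonzero
    by (simp add: b_qcomb qcomb_closed closed skew products b_simps S_simps b_self)
qed

text \<open>A quaternionic line does not fill \<open>S\<close>, so projecting along it leaves some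
  nonzero \<open>z\<close>, which may be null because \<open>b\<close> can be indefinite.
  Nondegeneracy supplies a partner \<open>w\<close> of \<open>z\<close>, and one of
  \<open>z\<close>, the projected \<open>w\<close> and their sum is non-null.\<close>

lemma ex_nonnull_orth:
  assumes nondeg: "\<And>u. u \<in> S \<Longrightarrow> (\<And>v. v \<in> S \<Longrightarrow> b u v = 0) \<Longrightarrow> u = 0"
    and big: "\<And>B. finite B \<Longrightarrow> card B \<le> 4 \<Longrightarrow> \<not> S \<subseteq> span B"
    and y: "y \<in> S" and nn: "b y y \<noteq> 0"
  obtains z where "z \<in> S" "b z z \<noteq> 0" "qorth z y"
proof -
  have "card {y, I y, J y, K y} \<le> 4"
    by (intro order_trans[OF card_insert_le_m1]) (auto simp: card_insert_if)
  then obtain x where x: "x \<in> S" "x \<notin> span {y, I y, J y, K y}"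
    using big[of "{y, I y, J y, K y}"] by auto
  obtain c0 c1 c2 c3 where c: "qorth y (x - qcomb c0 c1 c2 c3 y)"
    using qorth_projection[OF y nn x(1)] .
  define z where "z = x - qcomb c0 c1 c2 c3 y"
  have z: "z \<in> S" using x y by (simp add: z_def S_simps qcomb_closed)
  have "qcomb c0 c1 c2 c3 y \<in> span {y, I y, J y, K y}"
    unfolding qcomb_def by (intro span_add span_scale span_base) auto
  then have "z \<noteq> 0" using x(2) by (auto simp: z_def)
  then obtain w where w: "w \<in> S" "b z w \<noteq> 0" using nondeg[OF z] by blast
  obtain d0 d1 d2 d3 where d: "qorth y (w - qcomb d0 d1 d2 d3 y)"
    using qorth_projection[OF y nn w(1)] .
  define w' where "w' = w - qcomb d0 d1 d2 d3 y"
  have w': "w' \<in> S" using w y by (simp add: w'_def S_simps qcomb_closed)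
  have zo: "qorth z y" and wo: "qorth w' y"
    using c d y z w' qorth_sym by (auto simp: z_def w'_def)
  \<comment> \<open>The part removed from \<open>w\<close> lies in the quaternionic line of
    \<open>y\<close>, to which \<open>z\<close> is orthogonal.\<close>
  have "b z w' = b z w"
    using zo y z w by (simp add: w'_def b_simps S_simps b_qcomb qcomb_closed qorth_def)
  then have zw: "b z w' \<noteq> 0" using w by simp
  consider "b z z \<noteq> 0" | "b w' w' \<noteq> 0" | "b z z = 0" "b w' w' = 0" by blast
  then show ?thesis
  proof cases
    case 3
    have "b (z + w') (z + w') = 2 * b z w'"
      using 3 z w' by (simp add: b_simps S_simps b_sym[OF w' z] b_sym[of "z + w'" z]
          b_sym[of "z + w'" w'])
    moreover have "qorth (z + w') y"
      using qorth_sym[of z y] qorth_sym[of w' y] zo wo z w' y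
      by (intro qorth_sym[of y]) (auto simp: qorth_iff b_simps S_simps)
    ultimately show ?thesis using zw z w' by (intro that[of "z + w'"]) (auto simp: S_simps)
  qed (use that z w' zo wo in auto)
qed

end

section \<open>Trilinear forms on a paraquaternionic module\<close>

text \<open>
  The relations among \<open>I\<close>, \<open>J\<close>, \<open>K\<close> are only required under \<open>F\<close>: local sections are total functions,
  for which \<open>I (I X) = e X\<close> holds on the given open set only.
\<close>

definition quat_rel :: "'x set \<Rightarrow> ('x \<Rightarrow> 'x) \<Rightarrow> ('x \<Rightarrow> 'x) \<Rightarrow> ('x \<Rightarrow> 'x) \<Rightarrow> real \<Rightarrow> real \<Rightarrow> real
    \<Rightarrow> ('x \<Rightarrow> real) \<Rightarrow> bool" where
  "quat_rel S I J K e f h F \<longleftrightarrow> (\<forall>X\<in>S.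
     F (I (I X)) = e * F X \<and> F (J (J X)) = f * F X \<and> F (K (K X)) = h * F X \<and>
     F (I (J X)) = - h * F (K X) \<and> F (J (I X)) = h * F (K X) \<and>
     F (J (K X)) = - e * F (I X) \<and> F (K (J X)) = e * F (I X) \<and>
     F (K (I X)) = - f * F (J X) \<and> F (I (K X)) = f * F (J X))"

lemma quat_relD:
  assumes "quat_rel S I J K e f h F" "X \<in> S"
  shows "F (I (I X)) = e * F X" "F (J (J X)) = f * F X" "F (K (K X)) = h * F X"
     "F (I (J X)) = - h * F (K X)" "F (J (I X)) = h * F (K X)"
     "F (J (K X)) = - e * F (I X)" "F (K (J X)) = e * F (I X)"
     "F (K (I X)) = - f * F (J X)" "F (I (K X)) = f * F (J X)"
  using assms unfolding quat_rel_def by auto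

lemma quat_rel_rotate: "quat_rel S I J K e f h F \<Longrightarrow> quat_rel S J K I f h e F"
  unfolding quat_rel_def by auto

lemma quat_rel_add:
  "quat_rel S I J K e f h F \<Longrightarrow> quat_rel S I J K e f h G \<Longrightarrow> quat_rel S I J K e f h (\<lambda>X. F X + G X)"
  unfolding quat_rel_def by (simp add: algebra_simps)

lemma quat_rel_scale:
  "quat_rel S I J K e f h F \<Longrightarrow> quat_rel S I J K e f h (\<lambda>X. c * F X)"
  unfolding quat_rel_def by (simp add: algebra_simps)

text \<open>The sign triples with \<open>e * f * h = - 1\<close>. The product table forces this:
  computing \<open>I (I (J u))\<close> in two ways gives \<open>e = - h * f\<close>. Three minus
  signs are the quaternions, one minus sign the paraquaternions.\<close>

definition quat_signs :: "real \<Rightarrow> real \<Rightarrow> real \<Rightarrow> bool" where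
  "quat_signs e f h \<longleftrightarrow> (e, f, h) \<in> {(1, 1, -1), (1, -1, 1), (-1, 1, 1), (-1, -1, -1)}"

lemma quat_signs_rotate: "quat_signs e f h \<Longrightarrow> quat_signs f h e"
  unfolding quat_signs_def by auto

text \<open>For \<open>F\<close> skew in its last two arguments this is the alternation of
  \<open>F\<close>; on \<open>dcom \<gamma> I\<close> it stands for the exterior derivative of
  \<omega> along \<open>H\<close>.\<close>

definition cyc3 :: "('x \<Rightarrow> 'x \<Rightarrow> 'x \<Rightarrow> real) \<Rightarrow> 'x \<Rightarrow> 'x \<Rightarrow> 'x \<Rightarrow> real" where
  "cyc3 F X Y Z = F X Y Z + F Y Z X + F Z X Y"

text \<open>
  For \<open>\<gamma> X Y Z = g(\<nabla>\<^sub>X Y, Z)\<close> and \<open>I\<close> skew with respect to \<open>g\<close>, this is the covariant derivative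
  \<open>(\<nabla>\<^sub>X \<omega>)(Y, Z)\<close> of \<open>\<omega> = g(I \<cdot>, \<cdot>)\<close>.
\<close>

definition dcom :: "('x \<Rightarrow> 'x \<Rightarrow> 'x \<Rightarrow> real) \<Rightarrow> ('x \<Rightarrow> 'x) \<Rightarrow> 'x \<Rightarrow> 'x \<Rightarrow> 'x \<Rightarrow> real" where
  "dcom \<gamma> I X Y Z = \<gamma> X (I Y) Z + \<gamma> X Y (I Z)"

text \<open>\<open>S\<close> will be a set of local sections. As \<open>\<gamma>\<close>
  differentiates its second argument and is not tensorial there, the relations among
  \<open>I\<close>, \<open>J\<close>, \<open>K\<close> are imposed on values of
  \<open>\<gamma>\<close>.\<close>

locale quat_cubic =
  fixes S :: "'x set" and I J K :: "'x \<Rightarrow> 'x" and e f h :: real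
    and \<gamma> :: "'x \<Rightarrow> 'x \<Rightarrow> 'x \<Rightarrow> real"
  assumes signs: "quat_signs e f h"
    and closed: "\<And>X. X \<in> S \<Longrightarrow> I X \<in> S" "\<And>X. X \<in> S \<Longrightarrow> J X \<in> S" "\<And>X. X \<in> S \<Longrightarrow> K X \<in> S"
    and rel2: "\<And>X Z. X \<in> S \<Longrightarrow> Z \<in> S \<Longrightarrow> quat_rel S I J K e f h (\<lambda>Y. \<gamma> X Y Z)"
    and rel3: "\<And>X Y. X \<in> S \<Longrightarrow> Y \<in> S \<Longrightarrow> quat_rel S I J K e f h (\<lambda>Z. \<gamma> X Y Z)"
begin

lemma rotate: "quat_cubic S J K I f h e \<gamma>"
  using signs closed rel2 rel3 by unfold_locales (auto intro: quat_signs_rotate quat_rel_rotate)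

lemmas r2 = quat_relD[OF rel2] and r3 = quat_relD[OF rel3]

text \<open>As the square of \<open>I\<close> is constant, the derivative of \<open>I\<close>
  anticommutes with \<open>I\<close>.\<close>

lemma dcom_shift:
  assumes "X \<in> S" "Y \<in> S" "Z \<in> S"
  shows "dcom \<gamma> I X (I Y) Z = dcom \<gamma> I X Y (I Z)"
  using assms by (simp add: dcom_def r2 r3 closed)

lemma dcom_shift2:
  assumes "X \<in> S" "Y \<in> S" "Z \<in> S"
  shows "dcom \<gamma> I X (I Y) (I Z) = e * dcom \<gamma> I X Y Z"
  using assms by (simp add: dcom_def r2 r3 closed algebra_simps)

text \<open>For \<open>I\<^sup>2 = -1\<close> the next two lemmas say that the derivative of \<open>\<omega>\<^sub>J + i \<omega>\<^sub>K\<close>, a form of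
  type (2,0) for \<open>I\<close>, has no component of type (0,2).\<close>

lemma dcom_JK_even:
  assumes "X \<in> S" "Y \<in> S" "Z \<in> S"
  shows "dcom \<gamma> K X (I Y) Z + dcom \<gamma> K X Y (I Z) =
    - f * dcom \<gamma> J X Y Z + h * dcom \<gamma> J X (I Y) (I Z)"
  using assms signs by (auto simp: dcom_def r2 r3 closed quat_signs_def)

lemma dcom_JK_odd:
  assumes "X \<in> S" "Y \<in> S" "Z \<in> S"
  shows "f * (dcom \<gamma> J X (I Y) Z + dcom \<gamma> J X Y (I Z)) =
    - e * dcom \<gamma> K X Y Z - dcom \<gamma> K X (I Y) (I Z)"
  using assms signs by (auto simp: dcom_def r2 r3 closed quat_signs_def)

text \<open>The Leibniz rule for \<open>J I = h K\<close>, with the outer \<open>J\<close> moved to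
  the last argument by skewness.\<close>

lemma dcom_product:
  assumes "X \<in> S" "Y \<in> S" "Z \<in> S"
  shows "dcom \<gamma> I X Y (J Z) = dcom \<gamma> J X (I Y) Z - h * dcom \<gamma> K X Y Z"
  using assms by (simp add: dcom_def r2 r3 closed algebra_simps)

text \<open>For \<open>e = - 1\<close> this is, up to the sign of i, the real part of the
  differential of \<omega>_J + i \<omega>_K on the (0,1)-vectors X + i I X, Y + i I Y, Z + i I Z.
  The three summands of \<open>cyc3\<close> vanish separately, by \<open>dcom_JK_even\<close> and
  \<open>dcom_JK_odd\<close> in the last two arguments.\<close>

lemma cyc_03:
  assumes X: "X \<in> S" and Y: "Y \<in> S" and Z: "Z \<in> S"
  defines "c \<equiv> \<lambda>L. cyc3 (dcom \<gamma> L)"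
  shows "c J X Y Z + e * (c J (I X) (I Y) Z + c J (I X) Y (I Z) + c J X (I Y) (I Z))
    + f * (c K (I X) Y Z + c K X (I Y) Z + c K X Y (I Z)) - h * c K (I X) (I Y) (I Z) = 0"
proof -
  note s = X Y Z closed(1)[OF X] closed(1)[OF Y] closed(1)[OF Z]
  note ev = dcom_JK_even[OF s(1,2,3)] dcom_JK_even[OF s(2,3,1)] dcom_JK_even[OF s(3,1,2)]
  note od = dcom_JK_odd[OF s(4,2,3)] dcom_JK_odd[OF s(5,3,1)] dcom_JK_odd[OF s(6,1,2)]
  from signs consider "e = 1" "f = 1" "h = -1" | "e = 1" "f = -1" "h = 1"
    | "e = -1" "f = 1" "h = 1" | "e = -1" "f = -1" "h = -1"
    unfolding quat_signs_def by auto
  then show ?thesis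
    by cases (use ev od in \<open>simp_all add: c_def cyc3_def\<close>)
qed

end

section \<open>Closed fundamental forms are parallel\<close>

locale quat_cubic_closed = quat_cubic +
  assumes skew: "\<And>X Y Z. X \<in> S \<Longrightarrow> Y \<in> S \<Longrightarrow> Z \<in> S \<Longrightarrow> dcom \<gamma> I X Z Y = - dcom \<gamma> I X Y Z"
    "\<And>X Y Z. X \<in> S \<Longrightarrow> Y \<in> S \<Longrightarrow> Z \<in> S \<Longrightarrow> dcom \<gamma> J X Z Y = - dcom \<gamma> J X Y Z"
    "\<And>X Y Z. X \<in> S \<Longrightarrow> Y \<in> S \<Longrightarrow> Z \<in> S \<Longrightarrow> dcom \<gamma> K X Z Y = - dcom \<gamma> K X Y Z"
  and cyc: "\<And>X Y Z. X \<in> S \<Longrightarrow> Y \<in> S \<Longrightarrow> Z \<in> S \<Longrightarrow> cyc3 (dcom \<gamma> I) X Y Z = 0"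
    "\<And>X Y Z. X \<in> S \<Longrightarrow> Y \<in> S \<Longrightarrow> Z \<in> S \<Longrightarrow> cyc3 (dcom \<gamma> J) X Y Z = 0"
    "\<And>X Y Z. X \<in> S \<Longrightarrow> Y \<in> S \<Longrightarrow> Z \<in> S \<Longrightarrow> cyc3 (dcom \<gamma> K) X Y Z = 0"
begin

text \<open>The almost Kaehler identity for \<open>I\<close>: combine closedness of \<omega>_I at
  \<open>(I X, Y, Z)\<close>, \<open>(X, I Y, Z)\<close>, \<open>(X, Y, I Z)\<close> and
  \<open>(I X, I Y, I Z)\<close>.\<close>

lemma dcom_I_first:
  assumes X: "X \<in> S" and Y: "Y \<in> S" and Z: "Z \<in> S"
  shows "dcom \<gamma> I (I X) Y Z = dcom \<gamma> I X (I Y) Z"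
proof -
  note s = X Y Z closed(1)[OF X] closed(1)[OF Y] closed(1)[OF Z]
  note c = cyc(1)[OF s(4,2,3)] cyc(1)[OF s(1,5,3)] cyc(1)[OF s(1,2,6)] cyc(1)[OF s(4,5,6)]
  note sh = dcom_shift[OF s(1,2,3)] dcom_shift[OF s(2,3,1)] dcom_shift[OF s(3,1,2)]
  note sh2 = dcom_shift2[OF s(4,2,3)] dcom_shift2[OF s(5,3,1)] dcom_shift2[OF s(6,1,2)]
  from signs consider "e = 1" | "e = -1" unfolding quat_signs_def by auto
  then show ?thesis by cases (use c sh sh2 in \<open>simp_all add: cyc3_def\<close>)
qed

text \<open>The difference of the two sides is computed by \<open>dcom_product\<close> at
  \<open>(X, Y)\<close> and at \<open>(I X, I Y)\<close>; by \<open>dcom_I_first\<close> the results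
  agree up to the factor \<open>e\<close>. Closedness of \<omega>_J and \<omega>_K moves
  \<open>Z\<close> into the first argument, where \<open>dcom_JK_odd\<close> cancels
  everything.\<close>

lemma dcom_I_symmetric_J:
  assumes X: "X \<in> S" and Y: "Y \<in> S" and Z: "Z \<in> S"
  shows "dcom \<gamma> I X Y (J Z) = dcom \<gamma> I Y X (J Z)"
proof -
  note s = X Y Z closed(1)[OF X] closed(1)[OF Y] closed(2)[OF Z]
  note p = dcom_product[OF s(1,2,3)] dcom_product[OF s(2,1,3)]
    dcom_product[OF s(4,5,3)] dcom_product[OF s(5,4,3)]
  have q: "dcom \<gamma> J (I X) (I (I Y)) Z = e * dcom \<gamma> J (I X) Y Z"
    "dcom \<gamma> J (I Y) (I (I X)) Z = e * dcom \<gamma> J (I Y) X Z"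
    using s signs by (auto simp: dcom_def r2 r3 closed quat_signs_def)
  have t: "dcom \<gamma> I (I X) (I Y) (J Z) = e * dcom \<gamma> I X Y (J Z)"
    "dcom \<gamma> I (I Y) (I X) (J Z) = e * dcom \<gamma> I Y X (J Z)"
    using dcom_I_first[OF s(1,5,6)] dcom_I_first[OF s(2,4,6)] s signs
    by (auto simp: dcom_def r2 r3 closed quat_signs_def)
  note c = cyc(3)[OF s(1,2,3)] cyc(3)[OF s(4,5,3)] cyc(2)[OF s(4,2,3)] cyc(2)[OF s(1,5,3)]
  note sk = skew(2)[OF s(2,4,3)] skew(2)[OF s(4,2,3)] skew(2)[OF s(1,5,3)] skew(2)[OF s(5,1,3)]
    skew(3)[OF s(2,1,3)] skew(3)[OF s(5,4,3)]
  note od = dcom_JK_odd[OF s(3,1,2)]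
  from signs consider "e = 1" "f = 1" "h = -1" | "e = 1" "f = -1" "h = 1"
    | "e = -1" "f = 1" "h = 1" | "e = -1" "f = -1" "h = -1"
    unfolding quat_signs_def by auto
  then show ?thesis
    by cases (use p q t c sk od in \<open>simp_all add: cyc3_def\<close>)
qed

text \<open>\<open>J\<close> is invertible, so the preceding symmetry holds for every last argument.
  A function symmetric in its first two and skew in its last two arguments vanishes.\<close>

lemma dcom_I_zero:
  assumes "X \<in> S" "Y \<in> S" "Z \<in> S"
  shows "dcom \<gamma> I X Y Z = 0"
proof -
  have sym: "dcom \<gamma> I X Y Z = dcom \<gamma> I Y X Z" if "X \<in> S" "Y \<in> S" "Z \<in> S" for X Y Z
  proof -
    have "dcom \<gamma> I U V (J (J Z)) = f * dcom \<gamma> I U V Z" if "U \<in> S" "V \<in> S" for U V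
      using that \<open>Z \<in> S\<close> signs by (auto simp: dcom_def r2 r3 closed quat_signs_def)
    then show ?thesis
      using dcom_I_symmetric_J[OF that(1,2) closed(2)[OF that(3)]] that signs
      by (auto simp: quat_signs_def)
  qed
  show ?thesis
    using sym[OF assms(1,2,3)] sym[OF assms(2,3,1)] sym[OF assms(3,1,2)]
      skew(1)[OF assms(1,2,3)] skew(1)[OF assms(2,1,3)] skew(1)[OF assms(3,1,2)]
    by simp
qed

end

section \<open>Fundamental forms that are closed up to torsion terms\<close>

locale quat_torsion = quat_cubic +
  fixes G :: "'x \<Rightarrow> 'x \<Rightarrow> real" and bIJ bIK bJI bJK bKI bKJ :: "'x \<Rightarrow> real"
  assumes Grel: "\<And>Y. Y \<in> S \<Longrightarrow> quat_rel S I J K e f h (G Y)"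
    and Gsym: "\<And>Y Z. Y \<in> S \<Longrightarrow> Z \<in> S \<Longrightarrow> G Y Z = G Z Y"
    and Gskew: "\<And>Y Z. Y \<in> S \<Longrightarrow> Z \<in> S \<Longrightarrow> G (I Y) Z = - G Y (I Z)"
      "\<And>Y Z. Y \<in> S \<Longrightarrow> Z \<in> S \<Longrightarrow> G (J Y) Z = - G Y (J Z)"
      "\<And>Y Z. Y \<in> S \<Longrightarrow> Z \<in> S \<Longrightarrow> G (K Y) Z = - G Y (K Z)"
    and dcom_skew: "\<And>X Y Z. X \<in> S \<Longrightarrow> Y \<in> S \<Longrightarrow> Z \<in> S \<Longrightarrow> dcom \<gamma> I X Z Y = - dcom \<gamma> I X Y Z"
      "\<And>X Y Z. X \<in> S \<Longrightarrow> Y \<in> S \<Longrightarrow> Z \<in> S \<Longrightarrow> dcom \<gamma> J X Z Y = - dcom \<gamma> J X Y Z"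
      "\<And>X Y Z. X \<in> S \<Longrightarrow> Y \<in> S \<Longrightarrow> Z \<in> S \<Longrightarrow> dcom \<gamma> K X Z Y = - dcom \<gamma> K X Y Z"
    and cyc_I: "\<And>X Y Z. X \<in> S \<Longrightarrow> Y \<in> S \<Longrightarrow> Z \<in> S \<Longrightarrow> cyc3 (dcom \<gamma> I) X Y Z =
      cyc3 (\<lambda>X Y Z. bIJ X * G (J Y) Z + bIK X * G (K Y) Z) X Y Z"
    and cyc_J: "\<And>X Y Z. X \<in> S \<Longrightarrow> Y \<in> S \<Longrightarrow> Z \<in> S \<Longrightarrow> cyc3 (dcom \<gamma> J) X Y Z =
      cyc3 (\<lambda>X Y Z. bJI X * G (I Y) Z + bJK X * G (K Y) Z) X Y Z"
    and cyc_K: "\<And>X Y Z. X \<in> S \<Longrightarrow> Y \<in> S \<Longrightarrow> Z \<in> S \<Longrightarrow> cyc3 (dcom \<gamma> K) X Y Z =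
      cyc3 (\<lambda>X Y Z. bKI X * G (I Y) Z + bKJ X * G (J Y) Z) X Y Z"
begin

lemma rotate_torsion: "quat_torsion S J K I f h e \<gamma> G bJK bJI bKJ bKI bIJ bIK"
proof -
  interpret r: quat_cubic S J K I f h e \<gamma> by (rule rotate)
  show ?thesis
  proof unfold_locales
    show "G Y Z = G Z Y" if "Y \<in> S" "Z \<in> S" for Y Z by (rule Gsym[OF that])
    show "dcom \<gamma> I X Z Y = - dcom \<gamma> I X Y Z" "dcom \<gamma> J X Z Y = - dcom \<gamma> J X Y Z"
      "dcom \<gamma> K X Z Y = - dcom \<gamma> K X Y Z" if "X \<in> S" "Y \<in> S" "Z \<in> S" for X Y Z
      by (rule dcom_skew[OF that])+
  qed (simp_all add: Gskew cyc_I cyc_J cyc_K add.commute quat_rel_rotate[OF Grel])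
qed

lemmas Gr = quat_relD[OF Grel]

lemma Gzero:
  assumes "Y \<in> S"
  shows "G Y (I Y) = 0" "G Y (J Y) = 0" "G Y (K Y) = 0"
  using assms Gskew[of Y Y] Gsym[of "I Y" Y] Gsym[of "J Y" Y] Gsym[of "K Y" Y] closed
  by auto

text \<open>Apply \<open>cyc_03\<close> to \<open>X\<close>, \<open>Y\<close>, \<open>K Y\<close>.
  Orthogonality kills the terms in which \<open>G\<close> involves \<open>X\<close> or
  \<open>I X\<close>, and \<open>Gzero\<close> those with a coefficient at \<open>I X\<close>. Only
  \<open>bJK X\<close> and \<open>bKJ X\<close>, each times \<open>G Y Y\<close>, survive.\<close>

lemma bJK_eq:
  assumes X: "X \<in> S" and Y: "Y \<in> S" and nn: "G Y Y \<noteq> 0"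
    and orth: "G Y X = 0" "G Y (I X) = 0" "G Y (J X) = 0" "G Y (K X) = 0"
  shows "bJK X = e * bKJ X"
proof -
  have orth': "G X Y = 0" "G X (I Y) = 0" "G X (J Y) = 0" "G X (K Y) = 0"
    using orth Gskew[OF X Y] Gsym[OF X Y] Gsym[OF Y closed(1)[OF X]] Gsym[OF Y closed(2)[OF X]]
      Gsym[OF Y closed(3)[OF X]] by simp_all
  note s = X Y closed(1)[OF X] closed(1)[OF Y] closed(3)[OF Y] closed(1)[OF closed(3)[OF Y]]
  note simps = cyc3_def Gskew Gr Gzero orth orth' s closed
  have J: "cyc3 (dcom \<gamma> J) X Y (K Y) = - h * (bJK X * G Y Y)"
    "cyc3 (dcom \<gamma> J) (I X) (I Y) (K Y) = 0"
    "cyc3 (dcom \<gamma> J) (I X) Y (I (K Y)) = 0"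
    "cyc3 (dcom \<gamma> J) X (I Y) (I (K Y)) = e * e * f * (bJK X * G Y Y)"
    by (subst cyc_J; simp add: simps)+
  have K: "cyc3 (dcom \<gamma> K) (I X) Y (K Y) = 0"
    "cyc3 (dcom \<gamma> K) X (I Y) (K Y) = - e * e * (bKJ X * G Y Y)"
    "cyc3 (dcom \<gamma> K) X Y (I (K Y)) = - f * f * (bKJ X * G Y Y)"
    "cyc3 (dcom \<gamma> K) (I X) (I Y) (I (K Y)) = 0"
    by (subst cyc_K; simp add: simps)+
  define x y where "x = bJK X * G Y Y" and "y = bKJ X * G Y Y"
  have "x = e * y"
    using cyc_03[OF s(1,2,5)] signs unfolding J K quat_signs_def x_def[symmetric] y_def[symmetric]
    by auto
  then show ?thesis using nn by (simp add: x_def y_def)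
qed

text \<open>Adding \<open>aI I + aJ J + aK K\<close> to the connection changes the derivatives of
  \<open>I\<close>, \<open>J\<close>, \<open>K\<close> by commutators, doubled by anticommutation
  (hence the halves). Three numbers must cancel six coefficients, and assumption \<open>b\<close> is
  the compatibility condition. The corrected \<open>\<gamma>'\<close> then falls under
  \<open>quat_cubic_closed\<close>.\<close>

lemma dcom_eq_torsion:
  assumes b: "\<And>X. X \<in> S \<Longrightarrow> bJK X = e * bKJ X" "\<And>X. X \<in> S \<Longrightarrow> bKI X = f * bIK X"
      "\<And>X. X \<in> S \<Longrightarrow> bIJ X = h * bJI X"
    and X: "X \<in> S" and Y: "Y \<in> S" and Z: "Z \<in> S"
  shows "dcom \<gamma> I X Y Z = bIJ X * G (J Y) Z + bIK X * G (K Y) Z"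
proof -
  \<comment> \<open>\<open>\<gamma>'\<close> belongs to the connection \<open>\<nabla> + aI I + aJ J + aK K\<close>; the coefficients cancel \<open>\<beta>\<close>.\<close>
  define aI where "aI X = h * bJK X / 2" for X
  define aJ where "aJ X = - h * bIK X / 2" for X
  define aK where "aK X = f * bIJ X / 2" for X
  define \<gamma>' where "\<gamma>' X Y Z = \<gamma> X Y Z + (aI X * G (I Y) Z + (aJ X * G (J Y) Z + aK X * G (K Y) Z))"
    for X Y Z
  have G2: "quat_rel S I J K e f h (\<lambda>Y. G (I Y) Z)" "quat_rel S I J K e f h (\<lambda>Y. G (J Y) Z)"
    "quat_rel S I J K e f h (\<lambda>Y. G (K Y) Z)" if "Z \<in> S" for Z
    using that signs unfolding quat_rel_def
    by (auto simp: Gskew Gr closed quat_signs_def)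
  have dI: "dcom \<gamma>' I X Y Z = dcom \<gamma> I X Y Z - (bIJ X * G (J Y) Z + bIK X * G (K Y) Z)"
    and dJ: "dcom \<gamma>' J X Y Z = dcom \<gamma> J X Y Z - (bJI X * G (I Y) Z + bJK X * G (K Y) Z)"
    and dK: "dcom \<gamma>' K X Y Z = dcom \<gamma> K X Y Z - (bKI X * G (I Y) Z + bKJ X * G (J Y) Z)"
    if "X \<in> S" "Y \<in> S" "Z \<in> S" for X Y Z
    using that signs
    by (auto simp: dcom_def \<gamma>'_def aI_def aJ_def aK_def Gskew Gr closed quat_signs_def b algebra_simps)
  have Gs: "G (I Y) Z = - G (I Z) Y" "G (J Y) Z = - G (J Z) Y" "G (K Y) Z = - G (K Z) Y"
    if "Y \<in> S" "Z \<in> S" for Y Z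
    using that Gskew[OF that] Gsym[OF that(1) closed(1)[OF that(2)]]
      Gsym[OF that(1) closed(2)[OF that(2)]] Gsym[OF that(1) closed(3)[OF that(2)]] by simp_all
  interpret q: quat_cubic_closed S I J K e f h \<gamma>'
  proof unfold_locales
    show "quat_rel S I J K e f h (\<lambda>Y. \<gamma>' X Y Z)" if "X \<in> S" "Z \<in> S" for X Z
      unfolding \<gamma>'_def using that by (intro quat_rel_add quat_rel_scale rel2 G2)
    show "quat_rel S I J K e f h (\<gamma>' X Y)" if "X \<in> S" "Y \<in> S" for X Y
      unfolding \<gamma>'_def using that by (intro quat_rel_add quat_rel_scale rel3 Grel closed)
    fix X Y Z assume S: "X \<in> S" "Y \<in> S" "Z \<in> S"
    show "dcom \<gamma>' I X Z Y = - dcom \<gamma>' I X Y Z" "dcom \<gamma>' J X Z Y = - dcom \<gamma>' J X Y Z"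
      "dcom \<gamma>' K X Z Y = - dcom \<gamma>' K X Y Z"
      unfolding dI[OF S] dJ[OF S] dK[OF S] dI[OF S(1,3,2)] dJ[OF S(1,3,2)] dK[OF S(1,3,2)]
        dcom_skew[OF S] Gs[OF S(3,2)] by simp_all
    show "cyc3 (dcom \<gamma>' I) X Y Z = 0"
      using cyc_I[OF S] by (simp add: cyc3_def dI S)
    show "cyc3 (dcom \<gamma>' J) X Y Z = 0"
      using cyc_J[OF S] by (simp add: cyc3_def dJ S)
    show "cyc3 (dcom \<gamma>' K) X Y Z = 0"
      using cyc_K[OF S] by (simp add: cyc3_def dK S)
  qed (use signs closed in auto)
  show ?thesis using q.dcom_I_zero[OF X Y Z] dI[OF X Y Z] by simp
qed

end

section \<open>The partial connection\<close>

lemma in_span3: "x \<in> span {a, b, c} \<longleftrightarrow> (\<exists>r s t. x = r *\<^sub>R a + s *\<^sub>R b + t *\<^sub>R c)"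
proof
  show "x \<in> span {a, b, c} \<Longrightarrow> \<exists>r s t. x = r *\<^sub>R a + s *\<^sub>R b + t *\<^sub>R c"
    by (auto simp: span_breakdown_eq algebra_simps)
  show "\<exists>r s t. x = r *\<^sub>R a + s *\<^sub>R b + t *\<^sub>R c \<Longrightarrow> x \<in> span {a, b, c}"
    by (elim exE, hypsubst) (intro span_add span_scale span_base; simp)
qed

context smooth_mfd
begin

lemma section_vector_field: "section_of A H W X \<Longrightarrow> vector_field A W X"
  and section_in: "section_of A H W X \<Longrightarrow> p \<in> W \<Longrightarrow> X p \<in> H p"
  unfolding section_of_def by auto

lemma section_subset: "section_of A H W X \<Longrightarrow> W' \<subseteq> W \<Longrightarrow> section_of A H W' X"
  unfolding section_of_def using vector_field_subset by blast

lemma section_add: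
  assumes "\<And>p. subspace (H p)" "section_of A H W X" "section_of A H W Y"
  shows "section_of A H W (\<lambda>q. X q + Y q)"
  using assms unfolding section_of_def by (auto intro: vector_field_add subspace_add)

lemma section_scale:
  assumes "\<And>p. subspace (H p)" "section_of A H W X" "smooth_fun A W f"
  shows "section_of A H W (\<lambda>q. f q *\<^sub>R X q)"
  using assms unfolding section_of_def by (auto intro: vector_field_scale subspace_scale)

end

text \<open>The local situation over \<open>U\<close>. \<open>H_big\<close> is the form in which the
  dimension bound enters the algebra: a quaternionic line is a proper subspace of each fibre of
  \<open>H\<close>.\<close>

locale pqc_local = smooth_mfd A
  for A :: "('m::{t2_space,second_countable_topology}, 'e::euclidean_space) atlas" +
  fixes H :: "'m \<Rightarrow> 'm tvec set"
    and PQ :: "'m \<Rightarrow> ('m tvec \<Rightarrow> 'm tvec) set"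
    and g :: "'m \<Rightarrow> 'm tvec \<Rightarrow> 'm tvec \<Rightarrow> real"
    and U :: "'m set"
    and \<eta> :: "nat \<Rightarrow> 'm \<Rightarrow> 'm tvec \<Rightarrow> real"
    and I :: "nat \<Rightarrow> 'm \<Rightarrow> 'm tvec \<Rightarrow> 'm tvec"
    and \<xi> :: "nat \<Rightarrow> 'm \<Rightarrow> 'm tvec"
    and V :: "'m \<Rightarrow> 'm tvec set"
    and D :: "('m \<Rightarrow> 'm tvec) \<Rightarrow> ('m \<Rightarrow> 'm tvec) \<Rightarrow> 'm \<Rightarrow> 'm tvec"
  assumes H_subspace: "\<And>p. subspace (H p)"
    and section_ext: "\<And>W p u. open W \<Longrightarrow> p \<in> W \<Longrightarrow> u \<in> H p \<Longrightarrow>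
      \<exists>W' Y. open W' \<and> p \<in> W' \<and> W' \<subseteq> W \<and> section_of A H W' Y \<and> Y p = u"
    and H_big: "\<And>p B. finite B \<Longrightarrow> card B \<le> 4 \<Longrightarrow> \<not> H p \<subseteq> span B"
    and g_linear: "\<And>p u. u \<in> H p \<Longrightarrow> linear_on (H p) (g p u)"
    and g_sym: "\<And>p u v. u \<in> H p \<Longrightarrow> v \<in> H p \<Longrightarrow> g p u v = g p v u"
    and g_nondeg: "\<And>p u. u \<in> H p \<Longrightarrow> (\<And>v. v \<in> H p \<Longrightarrow> g p u v = 0) \<Longrightarrow> u = 0"
    and g_nonnull: "\<And>p. \<exists>u\<in>H p. g p u u \<noteq> 0"
    and g_smooth: "\<And>W X Y. open W \<Longrightarrow> section_of A H W X \<Longrightarrow> section_of A H W Y \<Longrightarrow>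
      smooth_fun A W (\<lambda>p. g p (X p) (Y p))"
    and data: "compatible_data A H PQ g U \<eta> I"
    and xi_field: "\<forall>s\<in>{1,2,3}. vector_field A U (\<xi> s)"
    and xi_dual: "\<forall>s\<in>{1,2,3}. \<forall>t\<in>{1,2,3}. \<forall>p\<in>U. \<eta> s p (\<xi> t p) = (if s = t then 1 else 0)"
    and xi_interior: "\<forall>s\<in>{1,2,3}.
          eq_on_distr A H U (interior_mult (\<xi> s) (ext_deriv A (\<eta> s))) (\<lambda>X p. 0)"
    and V: "\<forall>p\<in>U. V p = span {\<xi> 1 p, \<xi> 2 p, \<xi> 3 p}"
    and connection: "partial_connection A H U D"
    and metric: "metric_connection A H U g D"
    and torsion: "torsion_free_along A H V U D"
begin

lemmas data_conjs = data[unfolded compatible_data_def]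

lemmas data_fields = data_conjs[THEN conjunct2, THEN conjunct1]
  and data_PQ_eq = data_conjs[THEN conjunct2, THEN conjunct2, THEN conjunct1]
  and data_squares = data_conjs[THEN conjunct2, THEN conjunct2, THEN conjunct2, THEN conjunct1]
  and data_prods = data_conjs[THEN conjunct2, THEN conjunct2, THEN conjunct2, THEN conjunct2, THEN conjunct1]
  and data_isoms = data_conjs[THEN conjunct2, THEN conjunct2, THEN conjunct2, THEN conjunct2, THEN conjunct2, THEN conjunct1]
  and data_H_eq = data_conjs[THEN conjunct2, THEN conjunct2, THEN conjunct2, THEN conjunct2, THEN conjunct2, THEN conjunct2, THEN conjunct1]
  and data_dets = data_conjs[THEN conjunct2, THEN conjunct2, THEN conjunct2, THEN conjunct2, THEN conjunct2, THEN conjunct2, THEN conjunct2]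

lemma eta_linear: "s \<in> {1,2,3} \<Longrightarrow> p \<in> U \<Longrightarrow> linear_on (tangent_space A p) (\<eta> s p)"
  using data_fields unfolding one_form_def by blast

lemmas eta_simps = linear_onD[OF eta_linear subspace_tangent]

lemma I_field: "s \<in> {1,2,3} \<Longrightarrow> End_field A H U (I s)"
  using data_fields by blast

lemma I_End: "s \<in> {1,2,3} \<Longrightarrow> p \<in> U \<Longrightarrow> I s p \<in> End_space (H p)"
  using I_field unfolding End_field_def by simp

lemma I_in: "s \<in> {1,2,3} \<Longrightarrow> p \<in> U \<Longrightarrow> u \<in> H p \<Longrightarrow> I s p u \<in> H p"
  using I_End[of s p] unfolding End_space_def by simp

lemma I_section:
  assumes "s \<in> {1,2,3}" "open W" "W \<subseteq> U" "section_of A H W X"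
  shows "section_of A H W (\<lambda>q. I s q (X q))"
  using I_field[OF assms(1)] assms(2-4) unfolding End_field_def by simp

lemma PQ_span: "p \<in> U \<Longrightarrow> PQ p = span {I 1 p, I 2 p, I 3 p}"
  using data_PQ_eq by simp

lemma H_kernel: "p \<in> U \<Longrightarrow> u \<in> H p \<longleftrightarrow> u \<in> tangent_space A p \<and> (\<forall>s\<in>{1,2,3}. \<eta> s p u = 0)"
  using data_H_eq by simp

lemma H_tangent: "p \<in> U \<Longrightarrow> u \<in> H p \<Longrightarrow> u \<in> tangent_space A p"
  and eta_H: "p \<in> U \<Longrightarrow> u \<in> H p \<Longrightarrow> s \<in> {1,2,3} \<Longrightarrow> \<eta> s p u = 0"
  using H_kernel by blast+

lemma I_square: "p \<in> U \<Longrightarrow> u \<in> H p \<Longrightarrow> s \<in> {1,2,3} \<Longrightarrow> I s p (I s p u) = eps s *\<^sub>R u"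
  using data_squares by blast

lemma I_product: "p \<in> U \<Longrightarrow> u \<in> H p \<Longrightarrow> cyclic i j k \<Longrightarrow>
    I i p (I j p u) = - I j p (I i p u) \<and> I i p (I j p u) = - (eps k *\<^sub>R I k p u)"
  using data_prods by blast

lemma I_isometry: "p \<in> U \<Longrightarrow> u \<in> H p \<Longrightarrow> v \<in> H p \<Longrightarrow> s \<in> {1,2,3} \<Longrightarrow>
    g p (I s p u) (I s p v) = - eps s * g p u v"
  using data_isoms by blast

lemma deta: "open W \<Longrightarrow> W \<subseteq> U \<Longrightarrow> section_of A H W X \<Longrightarrow> section_of A H W Y \<Longrightarrow> p \<in> W \<Longrightarrow>
    s \<in> {1,2,3} \<Longrightarrow> ext_deriv A (\<eta> s) X Y p = - 2 * eps s * g p (I s p (X p)) (Y p)"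
  using data_dets by blast

lemmas g_simps = linear_onD[OF g_linear H_subspace]

lemma I_skew:
  assumes "p \<in> U" "u \<in> H p" "v \<in> H p" "s \<in> {1,2,3}"
  shows "g p (I s p u) v = - g p u (I s p v)"
proof -
  have "g p (I s p u) (I s p (I s p v)) = - eps s * g p u (I s p v)"
    by (rule I_isometry[OF assms(1,2) I_in[OF assms(4,1,3)] assms(4)])
  then have "eps s * g p (I s p u) v = - eps s * g p u (I s p v)"
    using assms by (simp add: I_square g_simps I_in del: insert_iff)
  then show ?thesis by (auto simp: eps_def split: if_splits)
qed

lemma quat_space_H:
  assumes p: "p \<in> U"
  shows "quat_space (H p) (g p) (I 1 p) (I 2 p) (I 3 p) 1 1 (- 1)"
proof
  fix u assume u: "u \<in> H p"
  have c: "cyclic 1 2 3" "cyclic 2 3 1" "cyclic 3 1 2" by (auto simp: cyclic_def)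
  note pr = I_product[OF p u c(1)] I_product[OF p u c(2)] I_product[OF p u c(3)]
  show "I 1 p (I 2 p u) = - (- 1) *\<^sub>R I 3 p u" "I 2 p (I 1 p u) = - 1 *\<^sub>R I 3 p u"
    "I 2 p (I 3 p u) = - 1 *\<^sub>R I 1 p u" "I 3 p (I 2 p u) = 1 *\<^sub>R I 1 p u"
    "I 3 p (I 1 p u) = - 1 *\<^sub>R I 2 p u" "I 1 p (I 3 p u) = 1 *\<^sub>R I 2 p u"
    using pr by (auto simp: eps_def equation_minus_iff)
  show "g p u v = g p v u" if "v \<in> H p" for v by (rule g_sym[OF u that])
qed (use p in \<open>simp_all add: H_subspace g_linear I_in I_square I_skew eps_def\<close>)

lemma D_section: "open W \<Longrightarrow> W \<subseteq> U \<Longrightarrow> section_of A H W X \<Longrightarrow> section_of A H W Y \<Longrightarrow>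
    section_of A H W (D X Y)"
  using connection unfolding partial_connection_def by simp

lemma D_add: "open W \<Longrightarrow> W \<subseteq> U \<Longrightarrow> section_of A H W X \<Longrightarrow> section_of A H W Y \<Longrightarrow>
    section_of A H W Y' \<Longrightarrow> p \<in> W \<Longrightarrow> D X (\<lambda>q. Y q + Y' q) p = D X Y p + D X Y' p"
  using connection unfolding partial_connection_def by simp

lemma D_scale: "open W \<Longrightarrow> W \<subseteq> U \<Longrightarrow> section_of A H W X \<Longrightarrow> section_of A H W Y \<Longrightarrow>
    smooth_fun A W f \<Longrightarrow> p \<in> W \<Longrightarrow>
    D X (\<lambda>q. f q *\<^sub>R Y q) p = X p f *\<^sub>R Y p + f p *\<^sub>R D X Y p"
  using connection unfolding partial_connection_def by simp

lemma D_cong: "open W \<Longrightarrow> W \<subseteq> U \<Longrightarrow> section_of A H W X \<Longrightarrow> section_of A H W Y \<Longrightarrow>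
    (\<And>q. q \<in> W \<Longrightarrow> Y q = Y' q) \<Longrightarrow> p \<in> W \<Longrightarrow> D X Y p = D X Y' p"
  using connection unfolding partial_connection_def by simp

lemma D_const_scale:
  assumes W: "open W" "W \<subseteq> U" and X: "section_of A H W X" and Y: "section_of A H W Y"
    and eq: "\<And>q. q \<in> W \<Longrightarrow> Y' q = c *\<^sub>R Y q" and p: "p \<in> W"
  shows "D X Y' p = c *\<^sub>R D X Y p"
proof -
  have "D X (\<lambda>q. c *\<^sub>R Y q) p = D X Y' p"
    by (rule D_cong[OF W X section_scale[OF H_subspace Y smooth_fun_const] _ p]) (simp add: eq)
  moreover have "X p (\<lambda>q. c) = 0"
    by (rule tangent_const[OF vector_field_tangent[OF section_vector_field[OF X] p] W(1) p refl])
  ultimately show ?thesis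
    using D_scale[OF W X Y smooth_fun_const p, of c] by simp
qed

lemma D_metric: "open W \<Longrightarrow> W \<subseteq> U \<Longrightarrow> section_of A H W X \<Longrightarrow> section_of A H W Y \<Longrightarrow>
    section_of A H W Z \<Longrightarrow> p \<in> W \<Longrightarrow>
    X p (\<lambda>q. g q (Y q) (Z q)) = g p (D X Y p) (Z p) + g p (Y p) (D X Z p)"
  using metric unfolding metric_connection_def by (simp add: algebra_simps)

text \<open>\<open>\<eta> s\<close> vanishes on sections of \<open>H\<close>, so only the bracket
  term of its exterior derivative survives.\<close>

lemma eta_bracket_H:
  assumes W: "open W" "W \<subseteq> U" and X: "section_of A H W X" and Y: "section_of A H W Y"
    and p: "p \<in> W" and s: "s \<in> {1,2,3}"
  shows "\<eta> s p (lie_bracket A X Y p) = 2 * eps s * g p (I s p (X p)) (Y p)"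
proof -
  have "v (\<lambda>q. \<eta> s q (Z q)) = 0" if "v \<in> tangent_space A p" "section_of A H W Z" for v Z
    by (rule tangent_const[OF that(1) W(1) p]) (use eta_H section_in[OF that(2)] s W(2) in blast)
  from this[OF vector_field_tangent[OF section_vector_field[OF X] p] Y]
    this[OF vector_field_tangent[OF section_vector_field[OF Y] p] X]
  show ?thesis using deta[OF W X Y p s] by (simp add: ext_deriv_def)
qed

lemma ext_deriv_xi:
  assumes W: "open W" "W \<subseteq> U" and X: "section_of A H W X"
    and p: "p \<in> W" and s: "s \<in> {1,2,3}" and t: "t \<in> {1,2,3}"
  shows "ext_deriv A (\<eta> s) (\<xi> t) X p = - \<eta> s p (lie_bracket A (\<xi> t) X p)"
proof -
  have "\<xi> t p \<in> tangent_space A p"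
    using xi_field t p W(2) vector_field_tangent by blast
  then have "\<xi> t p (\<lambda>q. \<eta> s q (X q)) = 0"
    by (rule tangent_const[OF _ W(1) p]) (use eta_H section_in[OF X] s W(2) in blast)
  moreover have "X p (\<lambda>q. \<eta> s q (\<xi> t q)) = 0"
    by (rule tangent_const[OF vector_field_tangent[OF section_vector_field[OF X] p] W(1) p,
          of _ "if s = t then 1 else 0"])
      (use xi_dual s t W(2) in blast)
  ultimately show ?thesis by (simp add: ext_deriv_def)
qed

text \<open>The forms \<open>\<eta> s\<close> read off the coefficients along the
  \<open>\<xi> s\<close>, which makes the splitting along \<open>V\<close> exist and be
  unique.\<close>

lemma proj_H:
  assumes p: "p \<in> U" and u: "u \<in> tangent_space A p"
  shows "proj_along (H p) (V p) u = u - (\<eta> 1 p u *\<^sub>R \<xi> 1 p + \<eta> 2 p u *\<^sub>R \<xi> 2 p + \<eta> 3 p u *\<^sub>R \<xi> 3 p)"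
proof -
  have xi: "\<xi> 1 p \<in> tangent_space A p" "\<xi> 2 p \<in> tangent_space A p" "\<xi> 3 p \<in> tangent_space A p"
    using xi_field p vector_field_tangent by blast+
  note T = subspace_add[OF subspace_tangent] subspace_scale[OF subspace_tangent]
    subspace_diff[OF subspace_tangent]
  define R where "R a b c = a *\<^sub>R \<xi> 1 p + b *\<^sub>R \<xi> 2 p + c *\<^sub>R \<xi> 3 p" for a b c
  have RT: "R a b c \<in> tangent_space A p" for a b c
    unfolding R_def by (intro T xi)
  have eta_R: "\<eta> 1 p (R a b c) = a" "\<eta> 2 p (R a b c) = b" "\<eta> 3 p (R a b c) = c" for a b c
    using xi_dual p xi unfolding R_def by (simp_all add: eta_simps T)
  have "(THE w. w \<in> H p \<and> u - w \<in> V p) = u - R (\<eta> 1 p u) (\<eta> 2 p u) (\<eta> 3 p u)"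
  proof (rule the_equality)
    show "u - R (\<eta> 1 p u) (\<eta> 2 p u) (\<eta> 3 p u) \<in> H p \<and>
        u - (u - R (\<eta> 1 p u) (\<eta> 2 p u) (\<eta> 3 p u)) \<in> V p"
    proof
      show "u - R (\<eta> 1 p u) (\<eta> 2 p u) (\<eta> 3 p u) \<in> H p"
        using p u RT by (simp add: H_kernel eta_simps T eta_R del: One_nat_def)
      show "u - (u - R (\<eta> 1 p u) (\<eta> 2 p u) (\<eta> 3 p u)) \<in> V p"
        unfolding diff_diff_eq2 add_diff_cancel_left' bspec[OF V p] in_span3 R_def by blast
    qed
    fix w assume w: "w \<in> H p \<and> u - w \<in> V p"
    then obtain a b c where abc: "u - w = R a b c"
      using V p unfolding R_def by (auto simp: in_span3)
    then have *: "u = w + R a b c" by (simp add: algebra_simps)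
    have "\<eta> 1 p u = a" "\<eta> 2 p u = b" "\<eta> 3 p u = c"
      using w p RT H_tangent[OF p] unfolding * by (simp_all add: eta_simps eta_R eta_H del: One_nat_def)
    with * show "w = u - R (\<eta> 1 p u) (\<eta> 2 p u) (\<eta> 3 p u)" by simp
  qed
  then show ?thesis unfolding proj_along_def R_def .
qed

text \<open>Vanishing torsion gives the component in \<open>H\<close>, and
  \<open>eta_bracket_H\<close> the one in \<open>V\<close>. The right-nested sum of scaled fields
  fits the bracket rules for sums and multiples.\<close>

lemma bracket_decomp:
  assumes W: "open W" "W \<subseteq> U" and X: "section_of A H W X" and Y: "section_of A H W Y"
    and p: "p \<in> W"
  defines "\<Omega> \<equiv> \<lambda>s. g p (I s p (X p)) (Y p)"
  shows "lie_bracket A X Y p = D X Y p + ((- 1) *\<^sub>R D Y X p + ((2 * eps 1 * \<Omega> 1) *\<^sub>R \<xi> 1 p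
    + ((2 * eps 2 * \<Omega> 2) *\<^sub>R \<xi> 2 p + (2 * eps 3 * \<Omega> 3) *\<^sub>R \<xi> 3 p)))"
proof -
  have pU: "p \<in> U" using p W by auto
  have T: "lie_bracket A X Y p \<in> tangent_space A p"
    by (rule vector_field_tangent[OF vector_field_lie_bracket[OF W(1)
          section_vector_field[OF X] section_vector_field[OF Y]] p])
  have "D X Y p - D Y X p = proj_along (H p) (V p) (lie_bracket A X Y p)"
    using torsion W X Y p unfolding torsion_free_along_def by simp
  then show ?thesis
    unfolding proj_H[OF pU T] using eta_bracket_H[OF W X Y p]
    by (simp add: \<Omega>_def algebra_simps)
qed

section \<open>Torsion coefficients from the Jacobi identity\<close>

abbreviation J :: "nat \<Rightarrow> ('m \<Rightarrow> 'm tvec) \<Rightarrow> 'm \<Rightarrow> 'm tvec" where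
  "J s X \<equiv> \<lambda>q. I s q (X q)"

definition \<gamma> :: "'m \<Rightarrow> ('m \<Rightarrow> 'm tvec) \<Rightarrow> ('m \<Rightarrow> 'm tvec) \<Rightarrow> ('m \<Rightarrow> 'm tvec) \<Rightarrow> real" where
  "\<gamma> p X Y Z = g p (D X Y p) (Z p)"

definition \<beta> :: "'m \<Rightarrow> nat \<Rightarrow> nat \<Rightarrow> ('m \<Rightarrow> 'm tvec) \<Rightarrow> real" where
  "\<beta> p s t X = eps s * eps t * \<eta> s p (lie_bracket A (\<xi> t) X p)"

text \<open>Expand the inner bracket by \<open>bracket_decomp\<close>. The outer brackets of its
  \<open>H\<close> part are given by \<open>eta_bracket_H\<close>; those of its \<open>V\<close>
  part produce \<open>\<beta>\<close> and, since the connection is metric, the terms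
  \<open>\<gamma> p Z\<close>.\<close>

lemma eta_double_bracket:
  assumes W: "open W" "W \<subseteq> U" and X: "section_of A H W X" and Y: "section_of A H W Y"
    and Z: "section_of A H W Z" and p: "p \<in> W" and s: "s \<in> {1,2,3}"
  shows "\<eta> s p (lie_bracket A (lie_bracket A X Y) Z p) =
    2 * eps s * (\<gamma> p Y X (J s Z) - \<gamma> p X Y (J s Z) - \<gamma> p Z (J s X) Y - \<gamma> p Z Y (J s X)
      + (\<Sum>t\<in>{1,2,3}. \<beta> p s t Z * g p (I t p (X p)) (Y p)))"
proof -
  have pU: "p \<in> U" using p W by auto
  define c where "c t q = 2 * eps t * g q (I t q (X q)) (Y q)" for t q
  have c_smooth: "smooth_fun A W (c t)" if "t \<in> {1,2,3}" for t
    unfolding c_def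
    by (rule smooth_fun_mult[OF W(1) smooth_fun_const g_smooth[OF W(1) I_section[OF that W X] Y]])
  define F where "F t = (\<lambda>q. c t q *\<^sub>R \<xi> t q)" for t
  have xi: "vector_field A W (\<xi> t)" if "t \<in> {1,2,3}" for t
    using xi_field that W(2) vector_field_subset by blast
  have F: "vector_field A W (F t)" if "t \<in> {1,2,3}" for t
    unfolding F_def by (rule vector_field_scale[OF xi[OF that] c_smooth[OF that]])
  have DXY: "section_of A H W (D X Y)" and DYX: "section_of A H W (D Y X)"
    using D_section[OF W] X Y by auto
  note v = section_vector_field[OF X] section_vector_field[OF Y] section_vector_field[OF Z]
    section_vector_field[OF DXY] section_vector_field[OF DYX]
  have mDYX: "vector_field A W (\<lambda>q. (- 1) *\<^sub>R D Y X q)"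
    by (rule vector_field_scale[OF v(5) smooth_fun_const])
  have s1: "(1::nat) \<in> {1,2,3}" "(2::nat) \<in> {1,2,3}" "(3::nat) \<in> {1,2,3}" by auto
  note f = F[OF s1(1)] F[OF s1(2)] F[OF s1(3)]
  note a1 = vector_field_add[OF f(2,3)]
  note a2 = vector_field_add[OF f(1) a1]
  note a3 = vector_field_add[OF mDYX a2]
  let ?b = "\<lambda>X. lie_bracket A X Z p"
  \<comment> \<open>The outer bracket differentiates its argument, so the decomposition is needed on
    \<open>W\<close>, not only at \<open>p\<close>.\<close>
  have "?b (lie_bracket A X Y) = ?b (\<lambda>q. D X Y q + ((- 1) *\<^sub>R D Y X q + (F 1 q + (F 2 q + F 3 q))))"
    by (rule lie_bracket_local[OF vector_field_lie_bracket[OF W(1) v(1,2)] v(3) W(1) p])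
      (unfold F_def c_def, rule bracket_decomp[OF W X Y])
  also have "\<dots> = ?b (D X Y) + (?b (\<lambda>q. (- 1) *\<^sub>R D Y X q) + (?b (F 1) + (?b (F 2) + ?b (F 3))))"
    by (simp only: lie_bracket_add_left[OF v(4) a3 v(3) W(1) p]
        lie_bracket_add_left[OF mDYX a2 v(3) W(1) p] lie_bracket_add_left[OF f(1) a1 v(3) W(1) p]
        lie_bracket_add_left[OF f(2,3) v(3) W(1) p])
  finally have main: "?b (lie_bracket A X Y) =
    ?b (D X Y) + (?b (\<lambda>q. (- 1) *\<^sub>R D Y X q) + (?b (F 1) + (?b (F 2) + ?b (F 3))))" .
  have T: "?b G \<in> tangent_space A p" if "vector_field A W G" for G
    by (rule vector_field_tangent[OF vector_field_lie_bracket[OF W(1) that v(3)] p])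
  note Ts = T[OF v(4)] T[OF mDYX] T[OF f(1)] T[OF f(2)] T[OF f(3)]
  note TT = subspace_add[OF subspace_tangent] subspace_scale[OF subspace_tangent]
    subspace_diff[OF subspace_tangent]
  \<comment> \<open>The derivative of the coefficient multiplies \<open>\<xi> t\<close>, so
    \<open>\<eta> s\<close> retains it only for \<open>t = s\<close>.\<close>
  have eta_F: "\<eta> s p (?b (F t)) = c t p * \<eta> s p (?b (\<xi> t)) - (if s = t then Z p (c t) else 0)"
    if t: "t \<in> {1,2,3}" for t
  proof -
    have "\<eta> s p (\<xi> t p) = (if s = t then 1 else 0)" using xi_dual s t pU by blast
    then show ?thesis
      unfolding F_def lie_bracket_scale_left[OF xi[OF t] v(3) c_smooth[OF t] W(1) p]
      using T[OF xi[OF t]] vector_field_tangent[OF xi[OF t] p]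
      by (auto simp: eta_simps[OF s pU] TT)
  qed
  have Zc: "Z p (c s) = 2 * eps s * (\<gamma> p Z (J s X) Y + \<gamma> p Z Y (J s X))"
  proof -
    note sX = I_section[OF s W X]
    have "Z p (c s) = 2 * eps s * Z p (\<lambda>q. g q (I s q (X q)) (Y q))"
      unfolding c_def
      using tangent_lin[OF vector_field_tangent[OF v(3) p] smooth_nearI[OF W(1) p g_smooth[OF W(1) sX Y]]
          smooth_near_const, of "2 * eps s" 0] by simp
    also have "Z p (\<lambda>q. g q (I s q (X q)) (Y q)) = \<gamma> p Z (J s X) Y + \<gamma> p Z Y (J s X)"
      unfolding \<gamma>_def D_metric[OF W Z sX Y p]
      using g_sym[OF section_in[OF sX p] section_in[OF D_section[OF W Z Y] p]] by simp
    finally show ?thesis .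
  qed
  have "?b (\<lambda>q. (- 1) *\<^sub>R D Y X q) = - ?b (D Y X)"
    using lie_bracket_scale_left[OF v(5,3) smooth_fun_const W(1) p, of "-1"]
      tangent_const[OF vector_field_tangent[OF v(3) p] W(1) p, of "\<lambda>q. - 1" "- 1"] by simp
  then have e2: "\<eta> s p (?b (\<lambda>q. (- 1) *\<^sub>R D Y X q)) = 2 * eps s * \<gamma> p Y X (J s Z)"
    using eta_bracket_H[OF W DYX Z p s] I_skew[OF pU section_in[OF DYX p] section_in[OF Z p] s]
      T[OF v(5)] by (simp add: eta_simps[OF s pU] \<gamma>_def)
  have e1: "\<eta> s p (?b (D X Y)) = - 2 * eps s * \<gamma> p X Y (J s Z)"
    using eta_bracket_H[OF W DXY Z p s] I_skew[OF pU section_in[OF DXY p] section_in[OF Z p] s]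
    by (simp add: \<gamma>_def)
  have ee: "eps s * (eps s * x) = x" for x by (auto simp: eps_def)
  have b: "c t p * \<eta> s p (?b (\<xi> t)) = 2 * eps s * (\<beta> p s t Z * g p (I t p (X p)) (Y p))" for t
    by (simp add: c_def \<beta>_def ee algebra_simps)
  have "\<eta> s p (?b (lie_bracket A X Y)) = \<eta> s p (?b (D X Y)) + (\<eta> s p (?b (\<lambda>q. (- 1) *\<^sub>R D Y X q))
      + (\<eta> s p (?b (F 1)) + (\<eta> s p (?b (F 2)) + \<eta> s p (?b (F 3)))))"
    unfolding main using Ts by (simp add: eta_simps[OF s pU] TT del: One_nat_def)
  also have "\<dots> = \<eta> s p (?b (D X Y)) + \<eta> s p (?b (\<lambda>q. (- 1) *\<^sub>R D Y X q))
      + (\<Sum>t\<in>{1,2,3}. \<eta> s p (?b (F t)))"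
    by simp
  also have "(\<Sum>t\<in>{1,2,3}. \<eta> s p (?b (F t))) =
      (\<Sum>t\<in>{1,2,3}. c t p * \<eta> s p (?b (\<xi> t))) - Z p (c s)"
    using s by (auto simp: eta_F)
  finally show ?thesis
    unfolding e1 e2 Zc b sum_distrib_left[symmetric] by (simp add: algebra_simps del: One_nat_def)
qed

text \<open>Of the twelve \<open>\<gamma>\<close> terms in the three double brackets six cancel; the
  other six are \<open>cyc3\<close> of \<open>dcom\<close> up to sign.\<close>

lemma cyc_torsion:
  assumes W: "open W" "W \<subseteq> U" and X: "section_of A H W X" and Y: "section_of A H W Y"
    and Z: "section_of A H W Z" and p: "p \<in> W" and s: "s \<in> {1,2,3}"
  shows "cyc3 (dcom (\<gamma> p) (J s)) X Y Z =
    (\<Sum>t\<in>{1,2,3}. cyc3 (\<lambda>X Y Z. \<beta> p s t X * g p (I t p (Y p)) (Z p)) X Y Z)"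
proof -
  have pU: "p \<in> U" using p W by auto
  note v = section_vector_field[OF X] section_vector_field[OF Y] section_vector_field[OF Z]
  note l = vector_field_lie_bracket[OF W(1)]
  note T = vector_field_tangent[OF l[OF l[OF v(1,2)] v(3)] p]
    vector_field_tangent[OF l[OF l[OF v(2,3)] v(1)] p] vector_field_tangent[OF l[OF l[OF v(3,1)] v(2)] p]
  have "\<eta> s p (lie_bracket A (lie_bracket A X Y) Z p) + \<eta> s p (lie_bracket A (lie_bracket A Y Z) X p)
      + \<eta> s p (lie_bracket A (lie_bracket A Z X) Y p) = \<eta> s p 0"
    unfolding jacobi[OF v W(1) p, symmetric]
    using T by (simp add: eta_simps[OF s pU] subspace_add[OF subspace_tangent])
  also have "\<eta> s p 0 = 0"
    using T by (simp add: eta_simps(5)[OF s pU])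
  finally have "2 * eps s * (- cyc3 (dcom (\<gamma> p) (J s)) X Y Z +
    (\<Sum>t\<in>{1,2,3}. cyc3 (\<lambda>X Y Z. \<beta> p s t X * g p (I t p (Y p)) (Z p)) X Y Z)) = 0"
    unfolding eta_double_bracket[OF W X Y Z p s] eta_double_bracket[OF W Y Z X p s]
      eta_double_bracket[OF W Z X Y p s] cyc3_def dcom_def sum.distrib
    by (simp add: algebra_simps del: One_nat_def)
  moreover have "eps s \<noteq> 0" by (simp add: eps_def)
  ultimately show ?thesis by simp
qed

lemma \<beta>_diag:
  assumes W: "open W" "W \<subseteq> U" and X: "section_of A H W X" and p: "p \<in> W" and s: "s \<in> {1,2,3}"
  shows "\<beta> p s s X = 0"
proof -
  have "ext_deriv A (\<eta> s) (\<xi> s) X p = 0"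
    using xi_interior s W X p unfolding eq_on_distr_def interior_mult_def by blast
  then show ?thesis using ext_deriv_xi[OF W X p s s] by (simp add: \<beta>_def)
qed

text \<open>Differentiate the skew-symmetry of \<open>I s\<close> along \<open>X\<close>, using that
  the connection is metric.\<close>

lemma dcom_J_skew:
  assumes W: "open W" "W \<subseteq> U" and X: "section_of A H W X" and Y: "section_of A H W Y"
    and Z: "section_of A H W Z" and p: "p \<in> W" and s: "s \<in> {1,2,3}"
  shows "dcom (\<gamma> p) (J s) X Z Y = - dcom (\<gamma> p) (J s) X Y Z"
proof -
  note sY = I_section[OF s W Y] and sZ = I_section[OF s W Z]
  note Xp = vector_field_tangent[OF section_vector_field[OF X] p]
  have "X p (\<lambda>q. g q (I s q (Y q)) (Z q) + g q (Y q) (I s q (Z q))) = 0"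
  proof (rule tangent_const[OF Xp W(1) p])
    fix q assume "q \<in> W"
    then show "g q (I s q (Y q)) (Z q) + g q (Y q) (I s q (Z q)) = 0"
      using I_skew[OF _ section_in[OF Y] section_in[OF Z] s, of q] W(2) by auto
  qed
  then have "X p (\<lambda>q. g q (I s q (Y q)) (Z q)) + X p (\<lambda>q. g q (Y q) (I s q (Z q))) = 0"
    using tangent_add[OF Xp smooth_nearI[OF W(1) p g_smooth[OF W(1) sY Z]]
        smooth_nearI[OF W(1) p g_smooth[OF W(1) Y sZ]]] by simp
  then show ?thesis
    unfolding D_metric[OF W X sY Z p] D_metric[OF W X Y sZ p] dcom_def \<gamma>_def
    using g_sym[OF section_in[OF sY p] section_in[OF D_section[OF W X Z] p]]
      g_sym[OF section_in[OF Y p] section_in[OF D_section[OF W X sZ] p]] by simp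
qed

lemma quat_rel_pointwise:
  assumes p: "p \<in> U" and W: "p \<in> W"
    and F: "\<And>u c. u \<in> H p \<Longrightarrow> \<Phi> (c *\<^sub>R u) = c * \<Phi> u"
  shows "quat_rel (Collect (section_of A H W)) (J 1) (J 2) (J 3) 1 1 (- 1) (\<lambda>X. \<Phi> (X p))"
proof -
  interpret q: quat_space "H p" "g p" "I 1 p" "I 2 p" "I 3 p" 1 1 "- 1"
    by (rule quat_space_H[OF p])
  show ?thesis
    unfolding quat_rel_def
    using section_in[of H W _ p] W F F[of _ "- 1"] q.products q.closed by simp
qed

lemma quat_torsion_sections:
  assumes W: "open W" "W \<subseteq> U" and p: "p \<in> W"
  shows "quat_torsion (Collect (section_of A H W)) (J 1) (J 2) (J 3) 1 1 (- 1) (\<gamma> p)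
    (\<lambda>Y Z. g p (Y p) (Z p)) (\<beta> p 1 2) (\<beta> p 1 3) (\<beta> p 2 1) (\<beta> p 2 3) (\<beta> p 3 1) (\<beta> p 3 2)"
proof -
  have pU: "p \<in> U" using p W by auto
  have s: "(1::nat) \<in> {1,2,3}" "(2::nat) \<in> {1,2,3}" "(3::nat) \<in> {1,2,3}" by auto
  let ?S = "Collect (section_of A H W)"
  have rel_g: "quat_rel ?S (J 1) (J 2) (J 3) 1 1 (- 1) (\<lambda>Z. g p u (Z p))" if "u \<in> H p" for u
    using that by (intro quat_rel_pointwise[OF pU p]) (simp_all add: g_simps)
  show ?thesis
  proof unfold_locales
    fix X Y assume "X \<in> ?S" "Y \<in> ?S"
    then show "quat_rel ?S (J 1) (J 2) (J 3) 1 1 (- 1) (\<gamma> p X Y)"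
      unfolding \<gamma>_def by (intro rel_g section_in[OF D_section[OF W] p]) auto
  next
    fix X Z assume XZ: "X \<in> ?S" "Z \<in> ?S"
    \<comment> \<open>An identity of sections on \<open>W\<close> with a constant factor passes
      through \<open>D\<close>; all nine product relations are of this kind.\<close>
    have sc: "\<gamma> p X Y' Z = c * \<gamma> p X Y Z"
      if "section_of A H W Y" "\<And>q. q \<in> W \<Longrightarrow> Y' q = c *\<^sub>R Y q" for Y Y' c
    proof -
      have "D X Y' p = c *\<^sub>R D X Y p"
        using XZ that by (intro D_const_scale[OF W _ _ _ p]) auto
      then show ?thesis
        using XZ that section_in[OF D_section[OF W] p, of X Y] section_in[OF _ p, of H Z]
          g_sym[of _ p "Z p"] H_subspace[of p]
        by (simp add: \<gamma>_def g_simps subspace_scale)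
    qed
    show "quat_rel ?S (J 1) (J 2) (J 3) 1 1 (- 1) (\<lambda>Y. \<gamma> p X Y Z)"
      unfolding quat_rel_def
    proof (intro ballI conjI)
      fix Y assume "Y \<in> ?S"
      then have Y: "section_of A H W Y" by simp
      note Ys = Y I_section[OF s(1) W Y] I_section[OF s(2) W Y] I_section[OF s(3) W Y]
      have q: "quat_space (H q) (g q) (I 1 q) (I 2 q) (I 3 q) 1 1 (- 1) \<and> Y q \<in> H q"
        if "q \<in> W" for q using that W quat_space_H section_in[OF Y] by blast
      note pr = quat_space.products[of "H q" "g q" "I 1 q" "I 2 q" "I 3 q" 1 1 "- 1" "Y q" for q]
      show "\<gamma> p X (J 1 (J 1 Y)) Z = 1 * \<gamma> p X Y Z" "\<gamma> p X (J 2 (J 2 Y)) Z = 1 * \<gamma> p X Y Z"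
        "\<gamma> p X (J 3 (J 3 Y)) Z = - 1 * \<gamma> p X Y Z"
        by (rule sc[OF Ys(1)], use q pr in blast)+
      show "\<gamma> p X (J 1 (J 2 Y)) Z = - (- 1) * \<gamma> p X (J 3 Y) Z"
        "\<gamma> p X (J 2 (J 1 Y)) Z = - 1 * \<gamma> p X (J 3 Y) Z"
        by (rule sc[OF Ys(4)], use q pr in blast)+
      show "\<gamma> p X (J 2 (J 3 Y)) Z = - 1 * \<gamma> p X (J 1 Y) Z"
        "\<gamma> p X (J 3 (J 2 Y)) Z = 1 * \<gamma> p X (J 1 Y) Z"
        by (rule sc[OF Ys(2)], use q pr in blast)+
      show "\<gamma> p X (J 3 (J 1 Y)) Z = - 1 * \<gamma> p X (J 2 Y) Z"
        "\<gamma> p X (J 1 (J 3 Y)) Z = 1 * \<gamma> p X (J 2 Y) Z"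
        by (rule sc[OF Ys(3)], use q pr in blast)+
    qed
  next
    fix Y assume "Y \<in> ?S"
    then show "quat_rel ?S (J 1) (J 2) (J 3) 1 1 (- 1) (\<lambda>Z. g p (Y p) (Z p))"
      by (intro rel_g section_in[OF _ p]) auto
  next
    fix Y Z assume "Y \<in> ?S" "Z \<in> ?S"
    then have YZ: "Y p \<in> H p" "Z p \<in> H p" using section_in[OF _ p] by auto
    show "g p (Y p) (Z p) = g p (Z p) (Y p)" by (rule g_sym[OF YZ])
    show "g p (J 1 Y p) (Z p) = - g p (Y p) (J 1 Z p)" "g p (J 2 Y p) (Z p) = - g p (Y p) (J 2 Z p)"
      "g p (J 3 Y p) (Z p) = - g p (Y p) (J 3 Z p)"
      using I_skew[OF pU YZ] s by blast+
  next
    fix X Y Z assume "X \<in> ?S" "Y \<in> ?S" "Z \<in> ?S"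
    then have S: "section_of A H W X" "section_of A H W Y" "section_of A H W Z" by auto
    show "dcom (\<gamma> p) (J 1) X Z Y = - dcom (\<gamma> p) (J 1) X Y Z"
      "dcom (\<gamma> p) (J 2) X Z Y = - dcom (\<gamma> p) (J 2) X Y Z"
      "dcom (\<gamma> p) (J 3) X Z Y = - dcom (\<gamma> p) (J 3) X Y Z"
      using dcom_J_skew[OF W S p] s by blast+
    note c = cyc_torsion[OF W S p]
    note d = \<beta>_diag[OF W S(1) p] \<beta>_diag[OF W S(2) p] \<beta>_diag[OF W S(3) p]
    show "cyc3 (dcom (\<gamma> p) (J 1)) X Y Z = cyc3 (\<lambda>X Y Z. \<beta> p 1 2 X * g p (J 2 Y p) (Z p) +
        \<beta> p 1 3 X * g p (J 3 Y p) (Z p)) X Y Z"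
      using c[OF s(1)] d(1)[OF s(1)] d(2)[OF s(1)] d(3)[OF s(1)]
      by (simp add: cyc3_def del: One_nat_def)
    show "cyc3 (dcom (\<gamma> p) (J 2)) X Y Z = cyc3 (\<lambda>X Y Z. \<beta> p 2 1 X * g p (J 1 Y p) (Z p) +
        \<beta> p 2 3 X * g p (J 3 Y p) (Z p)) X Y Z"
      using c[OF s(2)] d(1)[OF s(2)] d(2)[OF s(2)] d(3)[OF s(2)]
      by (simp add: cyc3_def del: One_nat_def)
    show "cyc3 (dcom (\<gamma> p) (J 3)) X Y Z = cyc3 (\<lambda>X Y Z. \<beta> p 3 1 X * g p (J 1 Y p) (Z p) +
        \<beta> p 3 2 X * g p (J 2 Y p) (Z p)) X Y Z"
      using c[OF s(3)] d(1)[OF s(3)] d(2)[OF s(3)] d(3)[OF s(3)]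
      by (simp add: cyc3_def del: One_nat_def)
  qed (use I_section[OF s(1) W] I_section[OF s(2) W] I_section[OF s(3) W] in
      \<open>auto simp: quat_signs_def\<close>)
qed

end

lemma subspace_End_space:
  assumes S: "subspace S"
  shows "subspace (End_space S)"
  unfolding subspace_def End_space_def linear_on_def
  using subspace_0[OF S] subspace_add[OF S] subspace_scale[OF S]
  by (auto simp: scaleR_fun_def algebra_simps)

context smooth_mfd
begin

lemma section_cong:
  assumes X: "section_of A H W X" and W: "open W" and eq: "\<And>q. q \<in> W \<Longrightarrow> X q = X' q"
  shows "section_of A H W X'"
  unfolding section_of_def
proof
  show "vector_field A W X'"
  proof (rule vector_fieldI)
    show "X' p \<in> tangent_space A p" if "p \<in> W" for p
      using vector_field_tangent[OF section_vector_field[OF X] that] eq[OF that] by simp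
    show "smooth_fun A W' (\<lambda>p. X' p f)" if "open W'" "W' \<subseteq> W" "smooth_fun A W' f" for W' f
      by (rule smooth_fun_cong[OF vector_field_smooth[OF section_vector_field[OF X] that] that(1)])
        (use eq that(2) in auto)
  qed
  show "\<forall>p\<in>W. X' p \<in> H p" using section_in[OF X] eq by auto
qed

lemma lie_bracket_add_right:
  assumes Z: "vector_field A W Z" and X: "vector_field A W X" and Y: "vector_field A W Y"
    and W: "open W" "p \<in> W"
  shows "lie_bracket A Z (\<lambda>q. X q + Y q) p = lie_bracket A Z X p + lie_bracket A Z Y p"
  using lie_bracket_add_left[OF X Y Z W] lie_bracket_swap[of Z] by simp

lemma lie_bracket_const_scale_right:
  assumes Z: "vector_field A W Z" and X: "vector_field A W X" and W: "open W" "p \<in> W"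
  shows "lie_bracket A Z (\<lambda>q. c *\<^sub>R X q) p = c *\<^sub>R lie_bracket A Z X p"
  using lie_bracket_scale_left[OF X Z smooth_fun_const W, of c] lie_bracket_swap[of Z]
    tangent_const[OF vector_field_tangent[OF Z W(2)] W refl, of c] by simp

end

context pqc_local
begin

lemma xi_on: "W \<subseteq> U \<Longrightarrow> t \<in> {1,2,3} \<Longrightarrow> vector_field A W (\<xi> t)"
  using xi_field vector_field_subset by blast

section \<open>Symmetry of the torsion coefficients\<close>

lemma \<beta>_add:
  assumes W: "open W" "W \<subseteq> U" and X: "section_of A H W X" and Y: "section_of A H W Y"
    and p: "p \<in> W" and s: "s \<in> {1,2,3}" and t: "t \<in> {1,2,3}"
  shows "\<beta> p s t (\<lambda>q. X q + Y q) = \<beta> p s t X + \<beta> p s t Y"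
proof -
  note v = section_vector_field[OF X] section_vector_field[OF Y]
  have T: "lie_bracket A (\<xi> t) Z p \<in> tangent_space A p" if "vector_field A W Z" for Z
    by (rule vector_field_tangent[OF vector_field_lie_bracket[OF W(1) xi_on[OF W(2) t] that] p])
  show ?thesis
    unfolding \<beta>_def lie_bracket_add_right[OF xi_on[OF W(2) t] v W(1) p]
    using T[OF v(1)] T[OF v(2)] p W(2) s by (auto simp: eta_simps algebra_simps)
qed

lemma \<beta>_const_scale:
  assumes W: "open W" "W \<subseteq> U" and X: "section_of A H W X"
    and p: "p \<in> W" and s: "s \<in> {1,2,3}" and t: "t \<in> {1,2,3}"
  shows "\<beta> p s t (\<lambda>q. c *\<^sub>R X q) = c * \<beta> p s t X"
proof -
  note v = section_vector_field[OF X]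
  have T: "lie_bracket A (\<xi> t) X p \<in> tangent_space A p"
    by (rule vector_field_tangent[OF vector_field_lie_bracket[OF W(1) xi_on[OF W(2) t] v] p])
  show ?thesis
    unfolding \<beta>_def lie_bracket_const_scale_right[OF xi_on[OF W(2) t] v W(1) p]
    using T p W(2) s by (auto simp: eta_simps)
qed

text \<open>The factors 1, 1, -1 are the signs \<open>e\<close>, \<open>f\<close>, \<open>h\<close>
  of the \<open>quat_torsion\<close> instance, written out so that its lemmas match
  literally.\<close>

definition \<beta>_symmetric :: "'m \<Rightarrow> ('m \<Rightarrow> 'm tvec) \<Rightarrow> bool" where
  "\<beta>_symmetric p X \<longleftrightarrow>
    \<beta> p 2 3 X = 1 * \<beta> p 3 2 X \<and> \<beta> p 3 1 X = 1 * \<beta> p 1 3 X \<and> \<beta> p 1 2 X = - 1 * \<beta> p 2 1 X"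

lemma \<beta>_symmetric_orth:
  assumes W: "open W" "W \<subseteq> U" and p: "p \<in> W" and X: "section_of A H W X" and Y: "section_of A H W Y"
    and nn: "g p (Y p) (Y p) \<noteq> 0"
    and orth: "quat_space.qorth (g p) (I 1 p) (I 2 p) (I 3 p) (Y p) (X p)"
  shows "\<beta>_symmetric p X"
proof -
  interpret q: quat_space "H p" "g p" "I 1 p" "I 2 p" "I 3 p" 1 1 "- 1"
    by (rule quat_space_H) (use W p in auto)
  interpret t1: quat_torsion "Collect (section_of A H W)" "J 1" "J 2" "J 3" 1 1 "- 1" "\<gamma> p"
    "\<lambda>Y Z. g p (Y p) (Z p)" "\<beta> p 1 2" "\<beta> p 1 3" "\<beta> p 2 1" "\<beta> p 2 3" "\<beta> p 3 1" "\<beta> p 3 2"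
    by (rule quat_torsion_sections[OF W p])
  note t2 = t1.rotate_torsion
  note t3 = quat_torsion.rotate_torsion[OF t2]
  have XY: "X \<in> Collect (section_of A H W)" "Y \<in> Collect (section_of A H W)" using X Y by auto
  note o = orth[unfolded q.qorth_def]
  show ?thesis
    unfolding \<beta>_symmetric_def
    using t1.bJK_eq[OF XY nn] quat_torsion.bJK_eq[OF t2, OF XY nn] quat_torsion.bJK_eq[OF t3, OF XY nn] o
    by blast
qed

text \<open>Split \<open>X\<close> into \<open>X1\<close>, orthogonal at \<open>p\<close> to the
  quaternionic line of a non-null \<open>y\<close>, and \<open>X2\<close>, which at \<open>p\<close>
  lies in that line and so is orthogonal to a second non-null vector \<open>z\<close>. Then
  \<open>\<beta>_symmetric_orth\<close> applies to \<open>X1\<close> with \<open>y\<close> and to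
  \<open>X2\<close> with \<open>z\<close>.\<close>

lemma \<beta>_symmetric:
  assumes W: "open W" "W \<subseteq> U" and p: "p \<in> W" and X: "section_of A H W X"
  shows "\<beta>_symmetric p X"
proof -
  interpret q: quat_space "H p" "g p" "I 1 p" "I 2 p" "I 3 p" 1 1 "- 1"
    by (rule quat_space_H) (use W p in auto)
  obtain y where y: "y \<in> H p" "g p y y \<noteq> 0" using g_nonnull by blast
  obtain z where z: "z \<in> H p" "g p z z \<noteq> 0" "q.qorth z y"
  proof (rule q.ex_nonnull_orth[OF _ _ y])
    show "u = 0" if "u \<in> H p" "\<And>v. v \<in> H p \<Longrightarrow> g p u v = 0" for u
      using that by (rule g_nondeg)
    show "\<not> H p \<subseteq> span B" if "finite B" "card B \<le> 4" for B
      using that by (rule H_big)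
  qed (rule that)
  obtain W1 Y where Y: "open W1" "p \<in> W1" "W1 \<subseteq> W" "section_of A H W1 Y" "Y p = y"
    using section_ext[OF W(1) p y(1)] by blast
  obtain W2 Z where Z: "open W2" "p \<in> W2" "W2 \<subseteq> W1" "section_of A H W2 Z" "Z p = z"
    using section_ext[OF Y(1,2) z(1)] by blast
  have W2: "open W2" "W2 \<subseteq> U" using Z Y W by auto
  have s: "(1::nat) \<in> {1,2,3}" "(2::nat) \<in> {1,2,3}" "(3::nat) \<in> {1,2,3}" by auto
  obtain c0 c1 c2 c3 where c: "q.qorth y (X p - q.qcomb c0 c1 c2 c3 y)"
    using q.qorth_projection[OF y section_in[OF X p]] .
  \<comment> \<open>\<open>X2\<close> is only constructed over \<open>W2\<close> from constant coefficients: additivity of \<open>\<beta>\<close> then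
    suffices and its tensoriality is not needed.\<close>
  define X2 where "X2 = (\<lambda>q. c0 *\<^sub>R Y q + (c1 *\<^sub>R J 1 Y q + (c2 *\<^sub>R J 2 Y q + c3 *\<^sub>R J 3 Y q)))"
  define X1 where "X1 = (\<lambda>q. X q + (- 1) *\<^sub>R X2 q)"
  note sY = section_subset[OF Y(4) Z(3)]
  note sc = section_scale[OF H_subspace _ smooth_fun_const]
  have sX: "section_of A H W2 X" by (rule section_subset[OF X]) (use Z Y in auto)
  have sX2: "section_of A H W2 X2"
    unfolding X2_def by (intro section_add[OF H_subspace] sc sY I_section[OF s(1) W2]
        I_section[OF s(2) W2] I_section[OF s(3) W2])
  have sX1: "section_of A H W2 X1"
    unfolding X1_def by (intro section_add[OF H_subspace] sc sX sX2)
  have p2: "X2 p = q.qcomb c0 c1 c2 c3 y" by (simp only: X2_def q.qcomb_def Y(5))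
  have sym1: "\<beta>_symmetric p X1"
    by (rule \<beta>_symmetric_orth[OF W2 Z(2) sX1 sY]) (use y c p2 in \<open>auto simp: Y(5) X1_def simp del: One_nat_def\<close>)
  have sym2: "\<beta>_symmetric p X2"
    by (rule \<beta>_symmetric_orth[OF W2 Z(2) sX2 Z(4)])
      (use z y q.qorth_qcomb in \<open>auto simp: Z(5) p2 simp del: One_nat_def\<close>)
  have "\<beta> p a b X1 = \<beta> p a b X - \<beta> p a b X2" if "a \<in> {1,2,3}" "b \<in> {1,2,3}" for a b
    unfolding X1_def \<beta>_add[OF W2 sX sc[OF sX2] Z(2) that] \<beta>_const_scale[OF W2 sX2 Z(2) that]
    by simp
  from this[OF s(1) s(2)] this[OF s(2) s(1)] this[OF s(1) s(3)] this[OF s(3) s(1)]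
    this[OF s(2) s(3)] this[OF s(3) s(2)]
  show ?thesis using sym1 sym2 unfolding \<beta>_symmetric_def by linarith
qed

section \<open>The derivatives of the \<open>I s\<close> and of sections of
  \<open>PQ\<close>\<close>

lemma dcom_J:
  assumes W: "open W" "W \<subseteq> U" and p: "p \<in> W" and X: "section_of A H W X"
    and Y: "section_of A H W Y" and Z: "section_of A H W Z" and s: "s \<in> {1,2,3}"
  shows "dcom (\<gamma> p) (J s) X Y Z = (\<Sum>t\<in>{1,2,3}. \<beta> p s t X * g p (I t p (Y p)) (Z p))"
proof -
  interpret t1: quat_torsion "Collect (section_of A H W)" "J 1" "J 2" "J 3" 1 1 "- 1" "\<gamma> p"
    "\<lambda>Y Z. g p (Y p) (Z p)" "\<beta> p 1 2" "\<beta> p 1 3" "\<beta> p 2 1" "\<beta> p 2 3" "\<beta> p 3 1" "\<beta> p 3 2"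
    by (rule quat_torsion_sections[OF W p])
  note t2 = t1.rotate_torsion
  note t3 = quat_torsion.rotate_torsion[OF t2]
  have XYZ: "X \<in> Collect (section_of A H W)" "Y \<in> Collect (section_of A H W)"
    "Z \<in> Collect (section_of A H W)" using X Y Z by auto
  have b: "\<beta> p 2 3 X = 1 * \<beta> p 3 2 X" "\<beta> p 3 1 X = 1 * \<beta> p 1 3 X" "\<beta> p 1 2 X = - 1 * \<beta> p 2 1 X"
    if "X \<in> Collect (section_of A H W)" for X
    using \<beta>_symmetric[OF W p] that unfolding \<beta>_symmetric_def by auto
  from s have "s = 1 \<or> s = 2 \<or> s = 3" by blast
  then show ?thesis
    using \<beta>_diag[OF W X p s] t1.dcom_eq_torsion[OF b(1) b(2) b(3) XYZ]
      quat_torsion.dcom_eq_torsion[OF t2, OF b(2) b(3) b(1) XYZ]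
      quat_torsion.dcom_eq_torsion[OF t3, OF b(3) b(1) b(2) XYZ]
    by (elim disjE) (simp_all del: One_nat_def)
qed

text \<open>Paired with an arbitrary vector, extended to a local section, this is
  \<open>dcom_J\<close>; nondegeneracy of \<open>g\<close> removes the pairing.\<close>

lemma D_J:
  assumes W: "open W" "W \<subseteq> U" and p: "p \<in> W" and X: "section_of A H W X"
    and Y: "section_of A H W Y" and s: "s \<in> {1,2,3}"
  shows "D X (J s Y) p = I s p (D X Y p) + (\<Sum>t\<in>{1,2,3}. \<beta> p s t X *\<^sub>R I t p (Y p))"
proof -
  have pU: "p \<in> U" using p W by auto
  note sY = I_section[OF s W Y]
  have in_H: "D X (J s Y) p \<in> H p" "I s p (D X Y p) \<in> H p" "D X Y p \<in> H p"
    using section_in[OF D_section[OF W X] p] I_in[OF s pU] Y sY by auto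
  have I_H: "I t p (Y p) \<in> H p" if "t \<in> {1,2,3}" for t
    by (rule I_in[OF that pU section_in[OF Y p]])
  have I_H': "I 1 p (Y p) \<in> H p" "I 2 p (Y p) \<in> H p" "I 3 p (Y p) \<in> H p" by (rule I_H; simp)+
  note T = subspace_add[OF H_subspace] subspace_scale[OF H_subspace] subspace_diff[OF H_subspace]
  define w where "w = \<beta> p s 1 X *\<^sub>R I 1 p (Y p) + (\<beta> p s 2 X *\<^sub>R I 2 p (Y p) + \<beta> p s 3 X *\<^sub>R I 3 p (Y p))"
  have w: "w \<in> H p" unfolding w_def by (intro T I_H')
  have "D X (J s Y) p - (I s p (D X Y p) + w) = 0"
  proof (rule g_nondeg)
    show "D X (J s Y) p - (I s p (D X Y p) + w) \<in> H p" by (intro T in_H w)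
    fix v assume v: "v \<in> H p"
    obtain W' Z where Z: "open W'" "p \<in> W'" "W' \<subseteq> W" "section_of A H W' Z" "Z p = v"
      using section_ext[OF W(1) p v] by blast
    have W': "open W'" "W' \<subseteq> U" using Z W by auto
    have d: "g p (D X (J s Y) p) v + g p (D X Y p) (I s p v) =
        (\<Sum>t\<in>{1,2,3}. \<beta> p s t X * g p (I t p (Y p)) v)"
      using dcom_J[OF W' Z(2) section_subset[OF X Z(3)] section_subset[OF Y Z(3)] Z(4) s]
      by (simp add: dcom_def \<gamma>_def Z(5) del: One_nat_def)
    have "g p v (D X (J s Y) p - (I s p (D X Y p) + w)) = 0"
      using d I_skew[OF pU in_H(3) v s] g_sym[OF v in_H(1)] g_sym[OF v in_H(2)]
        g_sym[OF v I_H'(1)] g_sym[OF v I_H'(2)] g_sym[OF v I_H'(3)] v in_H w I_H'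
      by (simp add: w_def g_simps[OF v] T del: One_nat_def)
    then show "g p (D X (J s Y) p - (I s p (D X Y p) + w)) v = 0"
      using g_sym[OF v, of "D X (J s Y) p - (I s p (D X Y p) + w)"] in_H w by (simp add: T)
  qed
  then show ?thesis by (simp add: w_def del: One_nat_def)
qed

lemma PQ_End_space:
  assumes p: "p \<in> U"
  shows "PQ p \<subseteq> End_space (H p)"
  unfolding PQ_span[OF p]
  by (rule span_minimal[OF _ subspace_End_space[OF H_subspace]]) (use I_End p in auto)

text \<open>The vectors \<open>I t p y\<close> are mutually orthogonal with squared lengths
  \<open>- eps t * g p y y\<close>, so pairing \<open>L y\<close> with them isolates the
  coefficients of \<open>L\<close>. Keeping \<open>g p y y\<close> on the left avoids a
  division.\<close>

lemma PQ_coefficients: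
  assumes p: "p \<in> U" and L: "L \<in> PQ p" and y: "y \<in> H p" and v: "v \<in> H p"
  shows "g p y y *\<^sub>R L v = (- eps 1 * g p (L y) (I 1 p y)) *\<^sub>R I 1 p v +
    ((- eps 2 * g p (L y) (I 2 p y)) *\<^sub>R I 2 p v + (- eps 3 * g p (L y) (I 3 p y)) *\<^sub>R I 3 p v)"
proof -
  interpret q: quat_space "H p" "g p" "I 1 p" "I 2 p" "I 3 p" 1 1 "- 1"
    by (rule quat_space_H[OF p])
  obtain r s t where L: "L = r *\<^sub>R I 1 p + s *\<^sub>R I 2 p + t *\<^sub>R I 3 p"
    using L PQ_span[OF p] by (auto simp: in_span3)
  have Lu: "L u = r *\<^sub>R I 1 p u + (s *\<^sub>R I 2 p u + t *\<^sub>R I 3 p u)" for u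
    by (simp add: L scaleR_fun_apply)
  have g: "g p (L y) x = r * g p (I 1 p y) x + (s * g p (I 2 p y) x + t * g p (I 3 p y) x)"
    if x: "x \<in> H p" for x
    unfolding Lu using x y q.closed q.S_simps
    by (simp add: q.b_simps g_sym[of _ p x] del: One_nat_def)
  have "g p (L y) (I 1 p y) = - r * g p y y" "g p (L y) (I 2 p y) = - s * g p y y"
    "g p (L y) (I 3 p y) = t * g p y y"
    by (simp_all add: g y q.closed q.skew q.products q.b_simps q.b_self del: One_nat_def)
  then show ?thesis by (simp add: Lu eps_def algebra_simps del: One_nat_def)
qed

text \<open>\<open>L\<close> is chosen before \<open>Y\<close>, which also shows that the derivative
  of \<open>\<sigma>\<close> at \<open>p\<close> depends on \<open>Y\<close> only through
  \<open>Y p\<close>.\<close>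

lemma D_PQ:
  assumes W: "open W" "W \<subseteq> U" and p: "p \<in> W" and X: "section_of A H W X"
    and \<sigma>: "End_section A H PQ W \<sigma>"
  obtains L where "L \<in> PQ p"
    "\<And>W' Y. open W' \<Longrightarrow> p \<in> W' \<Longrightarrow> W' \<subseteq> W \<Longrightarrow> section_of A H W' Y \<Longrightarrow>
      D X (\<lambda>q. \<sigma> q (Y q)) p - \<sigma> p (D X Y p) = L (Y p)"
proof -
  have pU: "p \<in> U" using p W by auto
  have s: "(1::nat) \<in> {1,2,3}" "(2::nat) \<in> {1,2,3}" "(3::nat) \<in> {1,2,3}" by auto
  have \<sigma>_section: "section_of A H W' (\<lambda>q. \<sigma> q (Y q))"
    if "open W'" "W' \<subseteq> W" "section_of A H W' Y" for W' Y
    using \<sigma> that unfolding End_section_def End_field_def by simp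
  have \<sigma>_PQ: "\<sigma> q \<in> PQ q" if "q \<in> W" for q using \<sigma> that unfolding End_section_def by simp
  obtain y where y: "y \<in> H p" "g p y y \<noteq> 0" using g_nonnull by blast
  obtain W1 N where N: "open W1" "p \<in> W1" "W1 \<subseteq> W" "section_of A H W1 N" "N p = y"
    using section_ext[OF W(1) p y(1)] by blast
  have W1: "open W1" "W1 \<subseteq> U" using N W by auto
  \<comment> \<open>Differentiating \<open>m \<sigma> = \<Sum>\<^sub>t h\<^sub>t I\<^sub>t\<close> avoids proving that the coefficients \<open>h\<^sub>t / m\<close> of \<open>\<sigma>\<close> are smooth.\<close>
  define m where "m q = g q (N q) (N q)" for q
  define h where "h t q = - eps t * g q (\<sigma> q (N q)) (I t q (N q))" for t q
  have m_smooth: "smooth_fun A W1 m" unfolding m_def by (rule g_smooth[OF N(1,4,4)])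
  have h_smooth: "smooth_fun A W1 (h t)" if "t \<in> {1,2,3}" for t
    unfolding h_def
    by (rule smooth_fun_mult[OF N(1) smooth_fun_const g_smooth[OF N(1) \<sigma>_section[OF N(1,3,4)]
            I_section[OF that W1 N(4)]]])
  have m\<sigma>: "m q *\<^sub>R \<sigma> q v = h 1 q *\<^sub>R I 1 q v + (h 2 q *\<^sub>R I 2 q v + h 3 q *\<^sub>R I 3 q v)"
    if "q \<in> W1" "v \<in> H q" for q v
    unfolding m_def h_def
    by (rule PQ_coefficients) (use that W1 N \<sigma>_PQ section_in[OF N(4)] in auto)
  have mp: "m p \<noteq> 0" using y N by (simp add: m_def)
  define B where "B t = \<beta> p t 1 X *\<^sub>R I 1 p + (\<beta> p t 2 X *\<^sub>R I 2 p + \<beta> p t 3 X *\<^sub>R I 3 p)" for t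
  \<comment> \<open>The Leibniz rule for the relation between \<open>m \<sigma>\<close> and the
    \<open>h t\<close>, solved for the derivative of \<open>\<sigma>\<close> at \<open>p\<close>; by
    \<open>D_J\<close>, \<open>B t\<close> is the derivative of \<open>I t\<close>.\<close>
  define L where "L = (1 / m p) *\<^sub>R ((X p (h 1) *\<^sub>R I 1 p + h 1 p *\<^sub>R B 1)
      + ((X p (h 2) *\<^sub>R I 2 p + h 2 p *\<^sub>R B 2) + (X p (h 3) *\<^sub>R I 3 p + h 3 p *\<^sub>R B 3))
      - X p m *\<^sub>R \<sigma> p)"
  show ?thesis
  proof
    have I_PQ: "I 1 p \<in> PQ p" "I 2 p \<in> PQ p" "I 3 p \<in> PQ p"
      unfolding PQ_span[OF pU] by (auto intro: span_base)
    have sub: "subspace (PQ p)" unfolding PQ_span[OF pU] by (rule subspace_span)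
    note T = subspace_add[OF sub] subspace_scale[OF sub] subspace_diff[OF sub]
    show "L \<in> PQ p"
      unfolding L_def B_def by (intro T I_PQ \<sigma>_PQ[OF p])
    fix W' Y assume W': "open W'" "p \<in> W'" "W' \<subseteq> W" and Y0: "section_of A H W' Y"
    define W2 where "W2 = W1 \<inter> W'"
    have W2: "open W2" "W2 \<subseteq> U" and p2: "p \<in> W2" and W2': "W2 \<subseteq> W1" "W2 \<subseteq> W"
      using W' N W1 by (auto simp: W2_def)
    have Y: "section_of A H W2 Y" and X2: "section_of A H W2 X"
      using section_subset[OF Y0] section_subset[OF X W2'(2)] by (auto simp: W2_def)
    note ms = smooth_fun_subset[OF m_smooth W2'(1)]
    note hs = smooth_fun_subset[OF h_smooth W2'(1)]
    note \<sigma>Y = \<sigma>_section[OF W2(1) W2'(2) Y]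
    note JY = I_section[OF s(1) W2 Y] I_section[OF s(2) W2 Y] I_section[OF s(3) W2 Y]
    note hJ = section_scale[OF H_subspace JY(1) hs[OF s(1)]]
      section_scale[OF H_subspace JY(2) hs[OF s(2)]] section_scale[OF H_subspace JY(3) hs[OF s(3)]]
    note hJ2 = section_add[OF H_subspace hJ(2,3)]
    have DY: "D X Y p \<in> H p" by (rule section_in[OF D_section[OF W2 X2 Y] p2])
    have Yp: "Y p \<in> H p" by (rule section_in[OF Y p2])
    have "D X (\<lambda>q. m q *\<^sub>R \<sigma> q (Y q)) p =
        D X (\<lambda>q. h 1 q *\<^sub>R J 1 Y q + (h 2 q *\<^sub>R J 2 Y q + h 3 q *\<^sub>R J 3 Y q)) p"
      by (rule D_cong[OF W2 X2 section_scale[OF H_subspace \<sigma>Y ms] _ p2])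
        (use m\<sigma> W2' section_in[OF Y] in blast)
    then have e1: "X p m *\<^sub>R \<sigma> p (Y p) + m p *\<^sub>R D X (\<lambda>q. \<sigma> q (Y q)) p =
        (X p (h 1) *\<^sub>R J 1 Y p + h 1 p *\<^sub>R D X (J 1 Y) p) +
        ((X p (h 2) *\<^sub>R J 2 Y p + h 2 p *\<^sub>R D X (J 2 Y) p) +
         (X p (h 3) *\<^sub>R J 3 Y p + h 3 p *\<^sub>R D X (J 3 Y) p))"
      unfolding D_scale[OF W2 X2 \<sigma>Y ms p2] D_add[OF W2 X2 hJ(1) hJ2 p2] D_add[OF W2 X2 hJ(2,3) p2]
        D_scale[OF W2 X2 JY(1) hs[OF s(1)] p2] D_scale[OF W2 X2 JY(2) hs[OF s(2)] p2]
        D_scale[OF W2 X2 JY(3) hs[OF s(3)] p2] .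
    have e2: "m p *\<^sub>R \<sigma> p (D X Y p) =
        h 1 p *\<^sub>R I 1 p (D X Y p) + (h 2 p *\<^sub>R I 2 p (D X Y p) + h 3 p *\<^sub>R I 3 p (D X Y p))"
      by (rule m\<sigma>[OF N(2) DY])
    have e3: "D X (J t Y) p = I t p (D X Y p) + B t (Y p)" if "t \<in> {1,2,3}" for t
      unfolding D_J[OF W2 p2 X2 Y that] B_def by (simp add: scaleR_fun_apply del: One_nat_def)
    have e4: "m p *\<^sub>R L (Y p) = (X p (h 1) *\<^sub>R J 1 Y p + h 1 p *\<^sub>R B 1 (Y p))
      + ((X p (h 2) *\<^sub>R J 2 Y p + h 2 p *\<^sub>R B 2 (Y p)) + (X p (h 3) *\<^sub>R J 3 Y p + h 3 p *\<^sub>R B 3 (Y p)))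
      - X p m *\<^sub>R \<sigma> p (Y p)"
      using mp by (simp add: L_def scaleR_fun_apply del: One_nat_def)
    have "X p m *\<^sub>R \<sigma> p (Y p) + m p *\<^sub>R D X (\<lambda>q. \<sigma> q (Y q)) p =
        X p m *\<^sub>R \<sigma> p (Y p) + (m p *\<^sub>R L (Y p) + m p *\<^sub>R \<sigma> p (D X Y p))"
      unfolding e1 e2 e4 e3[OF s(1)] e3[OF s(2)] e3[OF s(3)] by (simp add: algebra_simps del: One_nat_def)
    then have "m p *\<^sub>R (D X (\<lambda>q. \<sigma> q (Y q)) p - \<sigma> p (D X Y p)) = m p *\<^sub>R L (Y p)"
      by (simp add: scaleR_diff_right)
    then show "D X (\<lambda>q. \<sigma> q (Y q)) p - \<sigma> p (D X Y p) = L (Y p)" using mp by simp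
  qed
qed

lemma preserves_PQ: "preserves A H U D PQ"
  unfolding preserves_def
proof (intro allI impI, elim conjE)
  fix W X \<sigma> assume W: "open W" "W \<subseteq> U" and X: "section_of A H W X"
    and \<sigma>: "End_section A H PQ W \<sigma>"
  have \<sigma>_section: "section_of A H W' (\<lambda>q. \<sigma> q (Y q))"
    if "open W'" "W' \<subseteq> W" "section_of A H W' Y" for W' Y
    using \<sigma> that unfolding End_section_def End_field_def by simp
  have main: "End_deriv A H W D X \<sigma> p \<in> PQ p \<and> (\<forall>W' Y. open W' \<and> p \<in> W' \<and> W' \<subseteq> W \<and>
      section_of A H W' Y \<longrightarrow>
        End_deriv A H W D X \<sigma> p (Y p) = D X (\<lambda>q. \<sigma> q (Y q)) p - \<sigma> p (D X Y p))"
    if p: "p \<in> W" for p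
  proof -
    obtain L where L: "L \<in> PQ p" "\<And>W' Y. open W' \<Longrightarrow> p \<in> W' \<Longrightarrow> W' \<subseteq> W \<Longrightarrow> section_of A H W' Y \<Longrightarrow>
      D X (\<lambda>q. \<sigma> q (Y q)) p - \<sigma> p (D X Y p) = L (Y p)"
      using D_PQ[OF W p X \<sigma>] by blast
    have "End_deriv A H W D X \<sigma> p = L"
    proof
      fix u
      show "End_deriv A H W D X \<sigma> p u = L u"
      proof (cases "u \<in> H p")
        case True
        obtain W1 N where N: "open W1" "p \<in> W1" "W1 \<subseteq> W" "section_of A H W1 N" "N p = u"
          using section_ext[OF W(1) p True] by blast
        have "(THE w. \<forall>W' Y. open W' \<and> p \<in> W' \<and> W' \<subseteq> W \<and> section_of A H W' Y \<and> Y p = u \<longrightarrow>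
            w = D X (\<lambda>q. \<sigma> q (Y q)) p - \<sigma> p (D X Y p)) = L u"
        proof (rule the_equality)
          show "\<forall>W' Y. open W' \<and> p \<in> W' \<and> W' \<subseteq> W \<and> section_of A H W' Y \<and> Y p = u \<longrightarrow>
            L u = D X (\<lambda>q. \<sigma> q (Y q)) p - \<sigma> p (D X Y p)"
            using L(2) by metis
          fix w assume "\<forall>W' Y. open W' \<and> p \<in> W' \<and> W' \<subseteq> W \<and> section_of A H W' Y \<and> Y p = u \<longrightarrow>
            w = D X (\<lambda>q. \<sigma> q (Y q)) p - \<sigma> p (D X Y p)"
          then show "w = L u" using L(2)[OF N(1-4)] N by blast
        qed
        then show ?thesis using True by (simp add: End_deriv_def)
      next
        case False
        \<comment> \<open>Outside \<open>H p\<close> both sides are 0, by the convention that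
          endomorphisms are extended by 0.\<close>
        have "L \<in> End_space (H p)" using L(1) PQ_End_space p W by blast
        then show ?thesis using False by (simp add: End_deriv_def End_space_def)
      qed
    qed
    with L show ?thesis by auto
  qed
  show "End_section A H PQ W (End_deriv A H W D X \<sigma>)"
    unfolding End_section_def End_field_def
  proof (intro conjI ballI allI impI)
    show "End_deriv A H W D X \<sigma> p \<in> PQ p" if "p \<in> W" for p using main[OF that] by blast
    then show "End_deriv A H W D X \<sigma> p \<in> End_space (H p)" if "p \<in> W" for p
      using PQ_End_space that W by blast
  next
    fix W' Y assume "open W' \<and> W' \<subseteq> W \<and> section_of A H W' Y"
    then have W': "open W'" "W' \<subseteq> W" and Y: "section_of A H W' Y" by auto
    have W'U: "W' \<subseteq> U" using W' W by auto
    note X' = section_subset[OF X W'(2)]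
    note sDY = D_section[OF W'(1) W'U X' Y]
    \<comment> \<open>Smoothness of the induced derivative is read off from its defining difference,
      both of whose terms are sections.\<close>
    have "section_of A H W' (\<lambda>p. D X (\<lambda>q. \<sigma> q (Y q)) p + (- 1) *\<^sub>R \<sigma> p (D X Y p))"
      by (intro section_add[OF H_subspace] section_scale[OF H_subspace _ smooth_fun_const]
          D_section[OF W'(1) W'U X'] \<sigma>_section[OF W'] Y sDY)
    then show "section_of A H W' (\<lambda>p. End_deriv A H W D X \<sigma> p (Y p))"
    proof (rule section_cong[OF _ W'(1)])
      fix q assume q: "q \<in> W'"
      then have "End_deriv A H W D X \<sigma> q (Y q) = D X (\<lambda>q. \<sigma> q (Y q)) q - \<sigma> q (D X Y q)"
        using main[of q] W' Y by blast
      then show "D X (\<lambda>q. \<sigma> q (Y q)) q + (- 1) *\<^sub>R \<sigma> q (D X Y q) = End_deriv A H W D X \<sigma> q (Y q)"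
        by simp
    qed
  qed
qed

text \<open>\<open>\<beta> p i j\<close> and \<open>\<beta> p j i\<close> carry the same factor
  \<open>eps i * eps j\<close>, so their symmetry is the asserted relation between
  contractions.\<close>

lemma xi_exchange:
  assumes ijk: "cyclic i j k"
  shows "eq_on_distr A H U (interior_mult (\<xi> j) (ext_deriv A (\<eta> i)))
         (\<lambda>X p. eps k * interior_mult (\<xi> i) (ext_deriv A (\<eta> j)) X p)"
  unfolding eq_on_distr_def interior_mult_def
proof (intro allI impI ballI, elim conjE)
  fix W X p assume W: "open W" "W \<subseteq> U" and X: "section_of A H W X" and p: "p \<in> W"
  have ij: "i \<in> {1,2,3}" "j \<in> {1,2,3}" using ijk by (auto simp: cyclic_def)
  have "\<beta>_symmetric p X" by (rule \<beta>_symmetric[OF W p X])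
  then show "ext_deriv A (\<eta> i) (\<xi> j) X p = eps k * ext_deriv A (\<eta> j) (\<xi> i) X p"
    unfolding ext_deriv_xi[OF W X p ij] ext_deriv_xi[OF W X p ij(2,1)]
    using ijk by (auto simp: \<beta>_symmetric_def \<beta>_def cyclic_def eps_def)
qed

end

section \<open>Distributions and metrics\<close>

context smooth_mfd
begin

lemma distribution_frame:
  fixes H :: "'m \<Rightarrow> 'm tvec set"
  assumes "distribution_of_codim A c H"
  obtains r W E where "r + c = DIM('e)" "open W" "p \<in> W"
    "\<And>i. i < r \<Longrightarrow> vector_field A W (E i)"
    "\<And>q. q \<in> W \<Longrightarrow> inj_on (\<lambda>i. E i q) {..<r}"
    "\<And>q. q \<in> W \<Longrightarrow> independent ((\<lambda>i. E i q) ` {..<r})"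
    "\<And>q. q \<in> W \<Longrightarrow> H q = span ((\<lambda>i. E i q) ` {..<r})"
proof -
  obtain r where r: "r + c = DIM('e)" and "\<forall>p. \<exists>W E. open W \<and> p \<in> W \<and> (\<forall>i<r. vector_field A W (E i)) \<and>
      (\<forall>q\<in>W. inj_on (\<lambda>i. E i q) {..<r} \<and> independent ((\<lambda>i. E i q) ` {..<r}) \<and>
        H q = span ((\<lambda>i. E i q) ` {..<r}))"
    using assms unfolding distribution_of_codim_def by (elim exE conjE)
  then obtain W E where W: "open W" "p \<in> W" "\<forall>i<r. vector_field A W (E i)"
    "\<forall>q\<in>W. inj_on (\<lambda>i. E i q) {..<r} \<and> independent ((\<lambda>i. E i q) ` {..<r}) \<and>
        H q = span ((\<lambda>i. E i q) ` {..<r})"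
    by (elim allE[of _ p] exE conjE)
  show ?thesis
    by (rule that[OF r W(1,2)]) (use W(3,4) in simp_all)
qed

lemma distribution_subspace: "distribution_of_codim A c H \<Longrightarrow> subspace (H p)"
  by (rule distribution_frame[of c H p]) (simp_all add: subspace_span)

text \<open>Expand \<open>u\<close> in a local frame at \<open>p\<close> and keep the coefficients
  constant.\<close>

lemma distribution_section_ext:
  assumes H: "distribution_of_codim A c H" and W: "open W" "p \<in> W" and u: "u \<in> H p"
  shows "\<exists>W' Y. open W' \<and> p \<in> W' \<and> W' \<subseteq> W \<and> section_of A H W' Y \<and> Y p = u"
proof -
  obtain r W0 E where "r + c = DIM('e)" and W0: "open W0" "p \<in> W0"
    and E: "\<And>i. i < r \<Longrightarrow> vector_field A W0 (E i)"
    and "\<And>q. q \<in> W0 \<Longrightarrow> inj_on (\<lambda>i. E i q) {..<r}"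
      "\<And>q. q \<in> W0 \<Longrightarrow> independent ((\<lambda>i. E i q) ` {..<r})"
    and HE: "\<And>q. q \<in> W0 \<Longrightarrow> H q = span ((\<lambda>i. E i q) ` {..<r})"
    by (rule distribution_frame[OF H, of p]) (rule that, assumption+)
  define W' where "W' = W0 \<inter> W"
  have W': "open W'" "p \<in> W'" "W' \<subseteq> W0" "W' \<subseteq> W" using W W0 by (auto simp: W'_def)
  have sub: "subspace (H q)" for q by (rule distribution_subspace[OF H])
  have secE: "section_of A H W' (E i)" if "i < r" for i
    unfolding section_of_def using vector_field_subset[OF E[OF that] W'(3)] HE W'(3) that
    by (auto intro!: span_base)
  have "u \<in> span ((\<lambda>i. E i p) ` {..<r})" using HE[OF W0(2)] u by simp
  then have "\<exists>Y. section_of A H W' Y \<and> Y p = u"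
  proof (induction rule: span_induct_alt)
    case base
    have "section_of A H W' (\<lambda>q. 0)"
      unfolding section_of_def
      using subspace_0[OF sub] subspace_0[OF subspace_tangent]
      by (auto intro!: vector_fieldI simp: smooth_fun_const zero_fun_def)
    then show ?case by auto
  next
    case (step c x y)
    then obtain i Y where i: "i < r" "x = E i p" and Y: "section_of A H W' Y" "Y p = y" by auto
    have "section_of A H W' (\<lambda>q. c *\<^sub>R E i q + Y q)"
      by (intro section_add[OF sub] section_scale[OF sub] secE smooth_fun_const i Y)
    moreover have "c *\<^sub>R E i p + Y p = c *\<^sub>R x + y" using i Y by simp
    ultimately show ?case by blast
  qed
  then show ?thesis using W' by blast
qed

text \<open>A frame at \<open>p\<close> is an independent set of more than \<open>card B\<close>
  vectors.\<close>

lemma distribution_big: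
  fixes H :: "'m \<Rightarrow> 'm tvec set"
  assumes H: "distribution_of_codim A c H" and B: "finite B" "card B + c < DIM('e)"
  shows "\<not> H p \<subseteq> span B"
proof
  assume sub: "H p \<subseteq> span B"
  obtain r W E where r: "r + c = DIM('e)" and "open W" and p: "p \<in> W"
    and "\<And>i. i < r \<Longrightarrow> vector_field A W (E i)"
    and W: "\<And>q. q \<in> W \<Longrightarrow> inj_on (\<lambda>i. E i q) {..<r}"
      "\<And>q. q \<in> W \<Longrightarrow> independent ((\<lambda>i. E i q) ` {..<r})"
      "\<And>q. q \<in> W \<Longrightarrow> H q = span ((\<lambda>i. E i q) ` {..<r})"
    by (rule distribution_frame[OF H, of p]) (rule that, assumption+)
  note inj = W(1)[OF p] and ind = W(2)[OF p] and HE = W(3)[OF p]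
  have "(\<lambda>i. E i p) ` {..<r} \<subseteq> span B"
    by (rule subset_trans[OF span_superset sub[unfolded HE]])
  then have "card ((\<lambda>i. E i p) ` {..<r}) \<le> card B"
    using independent_span_bound[OF B(1) ind] by simp
  then show False using card_image[OF inj] r B(2) by simp
qed

end

lemma linear_on_sum:
  assumes L: "linear_on S L" and S: "subspace S" and "finite B" "\<And>w. w \<in> B \<Longrightarrow> w \<in> S"
  shows "L (\<Sum>w\<in>B. c w *\<^sub>R w) = (\<Sum>w\<in>B. c w *\<^sub>R L w)"
  using assms(3,4)
proof (induction rule: finite_induct)
  case empty
  then show ?case using linear_onD(5)[OF L S] by simp
next
  case (insert x B)
  have "(\<Sum>w\<in>B. c w *\<^sub>R w) \<in> S" "c x *\<^sub>R x \<in> S"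
    using insert.prems by (auto intro!: subspace_sum[OF S] subspace_scale[OF S])
  then show ?case using insert by (simp add: linear_onD[OF L S])
qed

text \<open>Pairing \<open>u\<close> with a vector of the orthogonal basis isolates one coefficient,
  times 1 or -1.\<close>

lemma signature_nondegenerate:
  assumes S: "subspace S" and b: "\<And>u. u \<in> S \<Longrightarrow> linear_on S (b u)"
    and sym: "\<And>u v. u \<in> S \<Longrightarrow> v \<in> S \<Longrightarrow> b u v = b v u"
    and sig: "has_signature S b k l" and u: "u \<in> S" and null: "\<And>v. v \<in> S \<Longrightarrow> b u v = 0"
  shows "u = 0"
proof -
  obtain P N where PN: "finite (P \<union> N)" "span (P \<union> N) = S"
    "\<And>x y. x \<in> P \<union> N \<Longrightarrow> y \<in> P \<union> N \<Longrightarrow> x \<noteq> y \<Longrightarrow> b x y = 0"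
    "\<And>x. x \<in> P \<union> N \<Longrightarrow> b x x \<noteq> 0"
  proof -
    obtain P N where fin: "finite P" "finite N" and span: "span (P \<union> N) = S"
      and orth: "\<forall>u\<in>P \<union> N. \<forall>v\<in>P \<union> N. u \<noteq> v \<longrightarrow> b u v = 0"
      and P: "\<forall>u\<in>P. b u u = 1" and N: "\<forall>u\<in>N. b u u = - 1"
      using sig unfolding has_signature_def by (elim exE conjE)
    show thesis
    proof (rule that[OF _ span])
      show "finite (P \<union> N)" using fin by simp
      show "b x y = 0" if "x \<in> P \<union> N" "y \<in> P \<union> N" "x \<noteq> y" for x y
        using orth that by blast
      show "b x x \<noteq> 0" if "x \<in> P \<union> N" for x using that P N by auto
    qed
  qed
  have B: "w \<in> S" if "w \<in> P \<union> N" for w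
    using span_base[OF that] by (simp only: PN(2))
  obtain c where c: "u = (\<Sum>w\<in>P \<union> N. c w *\<^sub>R w)"
    using u unfolding PN(2)[symmetric] span_finite[OF PN(1)] by auto
  have "c w = 0" if w: "w \<in> P \<union> N" for w
  proof -
    have "0 = b w u" using null[OF B[OF w]] sym[OF u B[OF w]] by simp
    also have "\<dots> = (\<Sum>x\<in>P \<union> N. c x *\<^sub>R b w x)"
      unfolding c by (rule linear_on_sum[OF b[OF B[OF w]] S PN(1) B])
    also have "\<dots> = (\<Sum>x\<in>P \<union> N. if x = w then c w * b w w else 0)"
      using PN(3)[OF w] by (intro sum.cong) auto
    also have "\<dots> = c w * b w w" using PN(1) w by simp
    finally show ?thesis using PN(4)[OF w] by simp
  qed
  then show ?thesis unfolding c by simp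
qed

section \<open>Passage from the pqc hypotheses to the local setting\<close>

theorem proposition3p3:
  fixes A :: "('m::{t2_space,second_countable_topology}, 'e::euclidean_space) atlas"
    and n :: nat
    and H :: "'m \<Rightarrow> 'm tvec set"
    and C :: "('m \<Rightarrow> 'm tvec \<Rightarrow> 'm tvec \<Rightarrow> real) set"
    and PQ :: "'m \<Rightarrow> ('m tvec \<Rightarrow> 'm tvec) set"
    and g :: "'m \<Rightarrow> 'm tvec \<Rightarrow> 'm tvec \<Rightarrow> real"
    and U :: "'m set"
    and \<eta> :: "nat \<Rightarrow> 'm \<Rightarrow> 'm tvec \<Rightarrow> real"
    and I :: "nat \<Rightarrow> 'm \<Rightarrow> 'm tvec \<Rightarrow> 'm tvec"
    and \<xi> :: "nat \<Rightarrow> 'm \<Rightarrow> 'm tvec"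
    and V :: "'m \<Rightarrow> 'm tvec set"
    and nabla :: "('m \<Rightarrow> 'm tvec) \<Rightarrow> ('m \<Rightarrow> 'm tvec) \<Rightarrow> 'm \<Rightarrow> 'm tvec"
  assumes pqc: "pqc_manifold n A H C PQ"
    and dim: "4 * n + 3 > 7"
    and g: "g \<in> C"
    and data: "compatible_data A H PQ g U \<eta> I"
    and xi_field: "\<forall>s\<in>{1,2,3}. vector_field A U (\<xi> s)"
    and xi_dual: "\<forall>s\<in>{1,2,3}. \<forall>t\<in>{1,2,3}. \<forall>p\<in>U. \<eta> s p (\<xi> t p) = (if s = t then 1 else 0)"
    and xi_interior: "\<forall>s\<in>{1,2,3}.
          eq_on_distr A H U (interior_mult (\<xi> s) (ext_deriv A (\<eta> s))) (\<lambda>X p. 0)"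
    and V: "\<forall>p\<in>U. V p = span {\<xi> 1 p, \<xi> 2 p, \<xi> 3 p}"
    and connection: "partial_connection A H U nabla"
    and metric: "metric_connection A H U g nabla"
    and torsion: "torsion_free_along A H V U nabla"
  shows "preserves A H U nabla PQ \<and>
    (\<forall>s\<in>{1,2,3}. \<forall>t\<in>{1,2,3}. \<forall>p\<in>U. \<eta> s p (\<xi> t p) = (if s = t then 1 else 0)) \<and>
    (\<forall>s\<in>{1,2,3}. eq_on_distr A H U (interior_mult (\<xi> s) (ext_deriv A (\<eta> s))) (\<lambda>X p. 0)) \<and>
    (\<forall>i j k. cyclic i j k \<longrightarrow>
       eq_on_distr A H U (interior_mult (\<xi> j) (ext_deriv A (\<eta> i)))
         (\<lambda>X p. eps k * interior_mult (\<xi> i) (ext_deriv A (\<eta> j)) X p))"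
proof -
  have A: "smooth_manifold A" and DIM: "DIM('e) = 4 * n + 3" and H: "distribution_of_codim A 3 H"
    using pqc unfolding pqc_manifold_def by blast+
  obtain g0 where g0: "metric_of_signature A H (2 * n) (2 * n) g0" and C: "C = conformal_class A H g0"
    using pqc unfolding pqc_manifold_def by blast
  \<comment> \<open>\<open>g\<close> is a positive multiple of a metric of known signature, from
    which it inherits nondegeneracy, smoothness and non-null vectors.\<close>
  obtain f where f: "smooth_fun A UNIV f" "\<And>p. f p > 0"
    and gf: "\<And>p u v. u \<in> H p \<Longrightarrow> v \<in> H p \<Longrightarrow> g p u v = f p * g0 p u v"
    using g unfolding C conformal_class_def by blast
  interpret smooth_mfd A by unfold_locales (rule A)
  have sub: "subspace (H p)" for p by (rule distribution_subspace[OF H])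
  have g0_lin: "linear_on (H p) (g0 p u)" if "u \<in> H p" for p u
    using g0 that unfolding metric_of_signature_def by simp
  have g0_sym: "g0 p u v = g0 p v u" if "u \<in> H p" "v \<in> H p" for p u v
    using g0 that unfolding metric_of_signature_def by simp
  have g0_sig: "has_signature (H p) (g0 p) (2 * n) (2 * n)" for p
    using g0 unfolding metric_of_signature_def by simp
  interpret pqc_local A H PQ g U \<eta> I \<xi> V nabla
  proof
    show "subspace (H p)" for p by (rule sub)
    show "\<exists>W' Y. open W' \<and> p \<in> W' \<and> W' \<subseteq> W \<and> section_of A H W' Y \<and> Y p = u"
      if "open W" "p \<in> W" "u \<in> H p" for W p u
      by (rule distribution_section_ext[OF H that])
    \<comment> \<open>The dimension bound gives 4 + 3 < 4 n + 3, so four vectors cannot span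
      \<open>H p\<close>.\<close>
    show "\<not> H p \<subseteq> span B" if "finite B" "card B \<le> 4" for p B
      by (rule distribution_big[OF H that(1)]) (use that dim DIM in auto)
    show "linear_on (H p) (g p u)" if "u \<in> H p" for p u
      using g0_lin[OF that] that subspace_add[OF sub] subspace_scale[OF sub]
      by (simp add: linear_on_def gf algebra_simps)
    show "g p u v = g p v u" if "u \<in> H p" "v \<in> H p" for p u v
      using that g0_sym[OF that] by (simp add: gf)
    show "u = 0" if u: "u \<in> H p" and null: "\<And>v. v \<in> H p \<Longrightarrow> g p u v = 0" for p u
    proof (rule signature_nondegenerate[OF sub g0_lin g0_sym g0_sig u])
      show "g0 p u v = 0" if "v \<in> H p" for v
        using null[OF that] gf[OF u that] f(2)[of p] by simp
    qed auto
    show "\<exists>u\<in>H p. g p u u \<noteq> 0" for p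
    proof -
      obtain P where P: "card P = 2 * n" "P \<subseteq> H p" "\<And>u. u \<in> P \<Longrightarrow> g0 p u u = 1"
        using g0_sig[of p] unfolding has_signature_def
        by (metis UnCI span_base subsetI)
      \<comment> \<open>\<open>P\<close> is nonempty because its cardinality \<open>2 * n\<close> is
        positive.\<close>
      then obtain u where "u \<in> P" using dim by fastforce
      then have "u \<in> H p" "g p u u \<noteq> 0" using P gf[of u p u] f(2)[of p] by auto
      then show ?thesis by blast
    qed
    show "smooth_fun A W (\<lambda>p. g p (X p) (Y p))"
      if W: "open W" and X: "section_of A H W X" and Y: "section_of A H W Y" for W X Y
    proof -
      have "smooth_fun A W (\<lambda>p. g0 p (X p) (Y p))"
        using g0 W X Y unfolding metric_of_signature_def by blast
      from smooth_fun_mult[OF W smooth_fun_subset[OF f(1)] this]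
      have "smooth_fun A W (\<lambda>p. f p * g0 p (X p) (Y p))" by simp
      then show ?thesis
        by (rule smooth_fun_cong[OF _ W]) (use gf section_in[OF X] section_in[OF Y] in simp)
    qed
  qed (fact data xi_field xi_dual xi_interior V connection metric torsion)+
  show ?thesis using preserves_PQ xi_exchange xi_dual xi_interior by blast
qed

end
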